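(* For all integers $n\ge 4$, $|\mathcal{B}(n,n-3)|=2^n+n2^{n-2}-2n$.
   Context: Let $\binom{[n]}{k}$ be the set of $k$-element subsets of $[n]=\{1,\dots,n\}$, each written in increasing order. For $X=[x_1<\dots<x_m]$ its packet is $P(X)=\{X\setminus\{x_i\}:1\le i\le m\}$. The lex order is the lexicographic order of increasing sequences and antilex is its reverse. A total order $\rho$ on $\binom{[n]}{k}$ is admissible if for every $X\in\binom{[n]}{k+1}$ the restriction $\rho|_{P(X)}$ is the lex or the antilex order on $P(X)$. $X,Y\in\binom{[n]}{k}$ commute if $P(X)\cap P(Y)=\varnothing$. Two admissible orders (written as sequences) are commutation equivalent if one is obtained from the other by a sequence of transpositions of adjacent commuting elements. The higher Bruhat order $\mathcal{B}(n,k)$ has as its underlying set the set of commutation equivalence classes of admissible orders on $\binom{[n]}{k}$. *)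

theory Defs
  imports Main
begin

definition ksubsets :: "nat \<Rightarrow> nat \<Rightarrow> nat set set" where
  "ksubsets n k = {X. X \<subseteq> {1..n} \<and> card X = k}"

definition packet :: "nat set \<Rightarrow> nat set set" where
  "packet X = {X - {x} | x. x \<in> X}"

definition lex_less :: "nat set \<Rightarrow> nat set \<Rightarrow> bool" where
  "lex_less X Y \<longleftrightarrow>
    (sorted_list_of_set X, sorted_list_of_set Y) \<in> lexord {(a, b). a < b}"

definition antilex_less :: "nat set \<Rightarrow> nat set \<Rightarrow> bool" where
  "antilex_less X Y \<longleftrightarrow> lex_less Y X"

(* A total order on a finite set is written as the repetition-free list of its elements
   in increasing order; restricting the order to a subset is then filtering the list. *)

definition total_orders :: "'a set \<Rightarrow> 'a list set" where
  "total_orders A = {\<rho>. distinct \<rho> \<and> set \<rho> = A}"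

definition restrict_order :: "'a list \<Rightarrow> 'a set \<Rightarrow> 'a list" where
  "restrict_order \<rho> B = filter (\<lambda>x. x \<in> B) \<rho>"

definition admissible_orders :: "nat \<Rightarrow> nat \<Rightarrow> nat set list set" where
  "admissible_orders n k =
    {\<rho> \<in> total_orders (ksubsets n k). \<forall>X \<in> ksubsets n (k + 1).
        sorted_wrt lex_less (restrict_order \<rho> (packet X)) \<or>
        sorted_wrt antilex_less (restrict_order \<rho> (packet X))}"

definition commute :: "nat set \<Rightarrow> nat set \<Rightarrow> bool" where
  "commute X Y \<longleftrightarrow> packet X \<inter> packet Y = {}"

definition commutation_moves :: "(nat set list \<times> nat set list) set" where
  "commutation_moves =
    {(us @ [X, Y] @ vs, us @ [Y, X] @ vs) | us X Y vs. commute X Y}"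

definition commutation_equiv :: "nat \<Rightarrow> nat \<Rightarrow> (nat set list \<times> nat set list) set" where
  "commutation_equiv n k =
    commutation_moves\<^sup>* \<inter> (admissible_orders n k \<times> admissible_orders n k)"

lemma equiv_commutation_equiv: "equiv (admissible_orders n k) (commutation_equiv n k)"
proof -
  have "sym commutation_moves"
    unfolding sym_def commutation_moves_def commute_def by blast
  then have "sym (commutation_moves\<^sup>*)"
    by (rule sym_rtrancl)
  then show ?thesis
    unfolding equiv_def refl_on_def sym_def trans_def commutation_equiv_def
    by (auto intro: rtrancl_trans)
qed

definition higher_bruhat :: "nat \<Rightarrow> nat \<Rightarrow> nat set list set set" where
  "higher_bruhat n k = admissible_orders n k // commutation_equiv n k"

end

theory Submission
  imports Defs
begin

text \<open>
  Replace every subset of \<open>[n]\<close> by its complement: the elements being ordered become triples,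
  and the packets become pairs \<open>e\<close>, the packet of \<open>e\<close> consisting of the triples that contain
  \<open>e\<close>. The pairs whose packet is in antilex order form a graph on \<open>[n]\<close>. It determines
  the relative order of all non-commuting elements, hence the commutation class, and in it every
  neighbourhood \<open>N(i)\<close> is an initial or a final segment of \<open>[n] - {i}\<close>, since a violating
  pattern would give a cycle of three triples. Conversely each such graph is realized by sorting the
  triples by an explicit rank, so it remains to count these graphs.

  Complementation halves the count to graphs where 1 and n are not adjacent. Then
  \<open>N(1) = {2..a}\<close>, and what is left is a graph on \<open>{2..n}\<close> in which \<open>N(i)\<close> is initial for
  \<open>i \<le> a\<close> and final for \<open>i > a\<close>. Such a graph either has no edge between
  \<open>L = {2..a}\<close> and \<open>R = {a+1..n}\<close>, and splits into two threshold graphs, or it contains all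
  edges inside \<open>L\<close> and inside \<open>R\<close>, and its edges between them form a nonempty Young diagram.
\<close>

section \<open>Counting graphs whose neighbourhoods are segments\<close>

definition pairs :: "nat set \<Rightarrow> nat set set" where
  "pairs V = {e. e \<subseteq> V \<and> card e = 2}"

lemma pair_in_pairs [simp]: "{a, b} \<in> pairs V \<longleftrightarrow> a \<in> V \<and> b \<in> V \<and> a \<noteq> b"
  by (auto simp: pairs_def card_insert_if)

lemma pairsE:
  assumes "e \<in> pairs V"
  obtains a b where "e = {a, b}" "a \<in> V" "b \<in> V" "a < b"
proof -
  obtain x y where xy: "e = {x, y}" "x \<noteq> y"
    using assms by (auto simp: pairs_def card_2_iff)
  show thesis
    using xy assms that[of x y] that[of y x] by (cases "x < y") (auto simp: insert_commute)
qed

lemma finite_pairs [simp]: "finite V \<Longrightarrow> finite (pairs V)"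
  by (rule finite_subset[of _ "Pow V"]) (auto simp: pairs_def)

lemma pairs_mono: "U \<subseteq> V \<Longrightarrow> pairs U \<subseteq> pairs V"
  by (auto simp: pairs_def)

lemma graph_eqI:
  assumes "E \<subseteq> pairs V" "E' \<subseteq> pairs V"
    and "\<And>a b. a \<in> V \<Longrightarrow> b \<in> V \<Longrightarrow> a < b \<Longrightarrow> {a, b} \<in> E \<longleftrightarrow> {a, b} \<in> E'"
  shows "E = E'"
  using assms by (blast elim: pairsE)

definition star :: "nat \<Rightarrow> nat set \<Rightarrow> nat set set" where
  "star v U = (\<lambda>u. {v, u}) ` U"

lemma pair_in_star: "{a, b} \<in> star v U \<longleftrightarrow> (a = v \<and> b \<in> U) \<or> (b = v \<and> a \<in> U)"
  by (auto simp: star_def doubleton_eq_iff)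

text \<open>Every element of \<open>star v U\<close> contains \<open>v\<close> and no pair from
  \<open>V\<close> does, so the added star can be stripped off again. This makes the counts below
  insensitive to attaching a vertex.\<close>

lemma inj_on_Un_star:
  assumes "v \<notin> V"
  shows "inj_on (\<lambda>E. E \<union> star v U) (Pow (pairs V))"
proof (rule inj_onI)
  fix E E' assume "E \<in> Pow (pairs V)" "E' \<in> Pow (pairs V)" "E \<union> star v U = E' \<union> star v U"
  moreover have "pairs V \<inter> star v U = {}"
    using assms by (auto simp: star_def)
  ultimately show "E = E'" by blast
qed

section \<open>Graphs with initial and final neighbourhoods\<close>

text \<open>Neighbourhoods of vertices in \<open>L\<close> are initial segments of the other
  vertices, those of vertices in \<open>R\<close> are final segments. The provisos
  \<open>i \<noteq> x\<close> and \<open>i \<noteq> y\<close> skip the vertex itself, as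
  \<open>{i}\<close> is never an edge.\<close>

definition mixed_graphs :: "nat set \<Rightarrow> nat set \<Rightarrow> nat set set set" where
  "mixed_graphs L R = {E. E \<subseteq> pairs (L \<union> R) \<and>
     (\<forall>x \<in> L \<union> R. \<forall>y \<in> L \<union> R. x < y \<longrightarrow>
        (\<forall>i \<in> L. i \<noteq> x \<and> {i, y} \<in> E \<longrightarrow> {i, x} \<in> E) \<and>
        (\<forall>i \<in> R. i \<noteq> y \<and> {i, x} \<in> E \<longrightarrow> {i, y} \<in> E))}"

lemma finite_mixed_graphs [simp]:
  assumes "finite L" "finite R"
  shows "finite (mixed_graphs L R)"
  by (rule finite_subset[of _ "Pow (pairs (L \<union> R))"]) (use assms in \<open>auto simp: mixed_graphs_def\<close>)

lemma mixed_graphsD: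
  assumes "E \<in> mixed_graphs L R"
  shows "E \<subseteq> pairs (L \<union> R)"
    and "i \<in> L \<Longrightarrow> x \<in> L \<union> R \<Longrightarrow> x < y \<Longrightarrow> i \<noteq> x \<Longrightarrow> {i, y} \<in> E \<Longrightarrow> {i, x} \<in> E"
    and "i \<in> R \<Longrightarrow> y \<in> L \<union> R \<Longrightarrow> x < y \<Longrightarrow> i \<noteq> y \<Longrightarrow> {i, x} \<in> E \<Longrightarrow> {i, y} \<in> E"
proof -
  show sub: "E \<subseteq> pairs (L \<union> R)"
    using assms by (auto simp: mixed_graphs_def)
  show "{i, x} \<in> E" if "i \<in> L" "x \<in> L \<union> R" "x < y" "i \<noteq> x" "{i, y} \<in> E"
  proof -
    have "y \<in> L \<union> R" using sub that by (meson pair_in_pairs subsetD)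
    with that assms show ?thesis unfolding mixed_graphs_def by blast
  qed
  show "{i, y} \<in> E" if "i \<in> R" "y \<in> L \<union> R" "x < y" "i \<noteq> y" "{i, x} \<in> E"
  proof -
    have "x \<in> L \<union> R" using sub that by (meson pair_in_pairs subsetD)
    with that assms show ?thesis unfolding mixed_graphs_def by blast
  qed
qed

lemma mixed_graphs_subset: "mixed_graphs L R \<subseteq> Pow (pairs (L \<union> R))"
  by (auto simp: mixed_graphs_def)

lemma mixed_graphsI:
  assumes "E \<subseteq> pairs (L \<union> R)"
    and "\<And>i x y. i \<in> L \<Longrightarrow> x \<in> L \<union> R \<Longrightarrow> y \<in> L \<union> R \<Longrightarrow> x < y \<Longrightarrow> i \<noteq> x \<Longrightarrow> i \<noteq> y \<Longrightarrow>
      {i, y} \<in> E \<Longrightarrow> {i, x} \<in> E"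
    and "\<And>i x y. i \<in> R \<Longrightarrow> x \<in> L \<union> R \<Longrightarrow> y \<in> L \<union> R \<Longrightarrow> x < y \<Longrightarrow> i \<noteq> x \<Longrightarrow> i \<noteq> y \<Longrightarrow>
      {i, x} \<in> E \<Longrightarrow> {i, y} \<in> E"
  shows "E \<in> mixed_graphs L R"
proof -
  have "a \<noteq> b" if "{a, b} \<in> E" for a b
    using that assms(1) by (meson pair_in_pairs subsetD)
  with assms show ?thesis unfolding mixed_graphs_def by blast
qed

text \<open>Either the least vertex is adjacent to all others or the greatest one is isolated.\<close>
lemma card_initial_graphs:
  assumes "finite V" "V \<noteq> {}"
  shows "card (mixed_graphs V {}) = 2 ^ (card V - 1)"
  using assms
proof (induction "card V" arbitrary: V rule: less_induct)
  case less
  show ?case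
  proof (cases "card V = 1")
    case True
    then obtain v where "V = {v}" by (auto simp: card_1_singleton_iff)
    then have "pairs V = {}" by (auto elim: pairsE)
    then have "mixed_graphs V {} = {{}}" by (auto simp: mixed_graphs_def)
    then show ?thesis using True by simp
  next
    case False
    define v where "v = Min V"
    define w where "w = Max V"
    have vw: "v \<in> V" "w \<in> V" "\<And>x. x \<in> V \<Longrightarrow> v \<le> x" "\<And>x. x \<in> V \<Longrightarrow> x \<le> w"
      using less.prems by (auto simp: v_def w_def)
    have card2: "card V \<ge> 2"
      using False less.prems by (metis One_nat_def Suc_1 Suc_leI card_gt_0_iff le_neq_implies_less)
    have "v \<noteq> w"
    proof
      assume "v = w"
      then have "V \<subseteq> {v}" using vw by force
      then have "card V \<le> 1" using card_mono[of "{v}" V] by simp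
      then show False using card2 by simp
    qed
    then have "v < w" using vw by force
    let ?f = "\<lambda>E. E \<union> star v (V - {v})"
    let ?A = "mixed_graphs (V - {v}) {}" and ?B = "mixed_graphs (V - {w}) {}"
    \<comment> \<open>The edge \<open>{v, w}\<close> decides. If it is present, the initial segment
      at \<open>v\<close> reaches the maximum \<open>w\<close>, so \<open>v\<close> is adjacent to
      everything and can be removed. If it is absent, the initial segment at \<open>w\<close> omits
      the minimum \<open>v\<close>, so it is empty and \<open>w\<close> can be removed.\<close>
    have eq: "mixed_graphs V {} = ?f ` ?A \<union> ?B"
    proof (intro equalityI subsetI)
      fix E assume E: "E \<in> mixed_graphs V {}"
      note D = mixed_graphsD[OF E, simplified]
      show "E \<in> ?f ` ?A \<union> ?B"
      proof (cases "{v, w} \<in> E")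
        case True
        have dom: "{v, x} \<in> E" if "x \<in> V" "x \<noteq> v" for x
          using D(2)[of v x w] True that vw by (cases "x = w") force+
        have "E \<inter> pairs (V - {v}) \<in> ?A"
          by (rule mixed_graphsI) (use D in auto)
        moreover have "E = ?f (E \<inter> pairs (V - {v}))"
        proof (rule graph_eqI[of _ V])
          show "?f (E \<inter> pairs (V - {v})) \<subseteq> pairs V"
            using D(1) vw by (auto simp: star_def)
        next
          fix a b assume "a \<in> V" "b \<in> V" "a < b"
          then show "{a, b} \<in> E \<longleftrightarrow> {a, b} \<in> ?f (E \<inter> pairs (V - {v}))"
            using dom[of a] dom[of b] by (auto simp: pair_in_star insert_commute)
        qed (rule D(1))
        ultimately show ?thesis by blast
      next
        case False
        have iso: "{x, w} \<notin> E" if "x \<in> V" "x \<noteq> w" for x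
        proof
          assume "{x, w} \<in> E"
          moreover from this False have "x \<noteq> v" by auto
          ultimately have "{w, v} \<in> E"
            using D(2)[of w v x] that vw(1,2) vw(3)[of x] \<open>v \<noteq> w\<close> by (simp add: insert_commute)
          then show False using False by (simp add: insert_commute)
        qed
        have "E \<in> ?B"
        proof (rule mixed_graphsI)
          show "E \<subseteq> pairs (V - {w} \<union> {})"
          proof
            fix e assume e: "e \<in> E"
            then obtain a b where "e = {a, b}" "a \<in> V" "b \<in> V" "a < b"
              using D(1) by (meson pairsE subsetD)
            with e iso[of a] iso[of b] show "e \<in> pairs (V - {w} \<union> {})"
              by (auto simp: insert_commute)
          qed
        qed (use D in auto)
        then show ?thesis by blast
      qed
    next
      fix E assume "E \<in> ?f ` ?A \<union> ?B"
      then show "E \<in> mixed_graphs V {}"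
      proof
        assume "E \<in> ?f ` ?A"
        then obtain F where F: "F \<in> ?A" "E = ?f F" by blast
        note D = mixed_graphsD[OF F(1), simplified]
        have E: "{a, b} \<in> E \<longleftrightarrow> {a, b} \<in> F \<or> a = v \<and> b \<in> V - {v} \<or> b = v \<and> a \<in> V - {v}" for a b
          by (simp add: F(2) pair_in_star)
        show ?thesis
        proof (rule mixed_graphsI)
          show "E \<subseteq> pairs (V \<union> {})"
            using D(1) pairs_mono[of "V - {v}" V] vw by (auto simp: F(2) star_def)
        next
          fix i x y assume "i \<in> V" "x \<in> V \<union> {}" "x < y" "i \<noteq> x" "i \<noteq> y" "{i, y} \<in> E"
          then show "{i, x} \<in> E"
            using D(2)[of i x y] vw(3)[of x] unfolding E by (cases "y = v") auto
        qed auto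
      next
        assume "E \<in> ?B"
        note D = mixed_graphsD[OF this, simplified]
        show ?thesis
        proof (rule mixed_graphsI)
          show "E \<subseteq> pairs (V \<union> {})"
            using D(1) pairs_mono[of "V - {w}" V] by auto
        next
          fix i x y assume *: "i \<in> V" "x \<in> V \<union> {}" "y \<in> V \<union> {}" "x < y" "i \<noteq> x" "i \<noteq> y" "{i, y} \<in> E"
          then have "{i, y} \<in> pairs (V - {w})" using D(1) by blast
          with * show "{i, x} \<in> E"
            using D(2)[of i x y] vw(4)[of y] by auto
        qed auto
      qed
    qed
    have disj: "?f ` ?A \<inter> ?B = {}"
    proof -
      have "{v, w} \<in> ?f E" for E
        using \<open>v < w\<close> vw by (simp add: pair_in_star)
      moreover have "{v, w} \<notin> E" if "E \<in> ?B" for E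
        using mixed_graphsD(1)[OF that] by force
      ultimately show ?thesis by blast
    qed
    have cards: "card (V - {v}) = card V - 1" "card (V - {w}) = card V - 1"
      using vw less.prems by auto
    have ne: "V - {v} \<noteq> {}" "V - {w} \<noteq> {}"
      using vw \<open>v \<noteq> w\<close> by auto
    have "card (mixed_graphs V {}) = card (?f ` ?A) + card ?B"
      unfolding eq by (rule card_Un_disjoint) (use less.prems disj in auto)
    also have "card (?f ` ?A) = card ?A"
      by (rule card_image, rule inj_on_subset[OF inj_on_Un_star[of v "V - {v}"]])
        (use mixed_graphs_subset[of "V - {v}" "{}"] in simp_all)
    also have "card ?A = 2 ^ (card V - 2)"
      using less.hyps[of "V - {v}"] less.prems cards ne card2 by (simp add: numeral_2_eq_2)
    also have "card ?B = 2 ^ (card V - 2)"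
      using less.hyps[of "V - {w}"] less.prems cards ne card2 by (simp add: numeral_2_eq_2)
    also have "2 ^ (card V - 2) + 2 ^ (card V - 2) = (2 :: nat) ^ (card V - 1)"
      using card2 by (metis Suc_diff_le diff_Suc_Suc mult_2 numeral_2_eq_2 power_Suc One_nat_def)
    finally show ?thesis .
  qed
qed

text \<open>Complementation inside \<open>pairs V\<close> exchanges initial and final
  neighbourhoods.\<close>

lemma card_final_graphs:
  assumes "finite V" "V \<noteq> {}"
  shows "card (mixed_graphs {} V) = 2 ^ (card V - 1)"
proof -
  let ?c = "\<lambda>E. pairs V - E"
  have "bij_betw ?c (mixed_graphs V {}) (mixed_graphs {} V)"
  proof (rule bij_betw_byWitness[where f' = ?c])
    show "\<forall>E \<in> mixed_graphs V {}. ?c (?c E) = E" "\<forall>E \<in> mixed_graphs {} V. ?c (?c E) = E"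
      using mixed_graphsD(1) by fastforce+
    show "?c ` mixed_graphs V {} \<subseteq> mixed_graphs {} V"
      by (auto intro!: mixed_graphsI dest: mixed_graphsD(2))
    show "?c ` mixed_graphs {} V \<subseteq> mixed_graphs V {}"
      by (auto intro!: mixed_graphsI dest: mixed_graphsD(3))
  qed
  then show ?thesis
    using card_initial_graphs[OF assms] by (simp add: bij_betw_same_card)
qed

section \<open>Young diagrams in a rectangle\<close>

definition staircases :: "nat set \<Rightarrow> nat set \<Rightarrow> (nat \<times> nat) set set" where
  "staircases L R = {F. F \<subseteq> L \<times> R \<and>
     (\<forall>(i, j) \<in> F. \<forall>i' \<in> L. \<forall>j' \<in> R. i \<le> i' \<and> j' \<le> j \<longrightarrow> (i', j') \<in> F)}"

lemma finite_staircases [simp]: "finite L \<Longrightarrow> finite R \<Longrightarrow> finite (staircases L R)"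
  by (rule finite_subset[of _ "Pow (L \<times> R)"]) (auto simp: staircases_def)

text \<open>Pascal's rule, applied at the corner \<open>(l, r)\<close> of the two maxima. If the
  corner is filled, so is the whole row of \<open>l\<close>, which can be deleted. If it is not, the
  whole column of \<open>r\<close> is empty and can be deleted.\<close>

lemma card_staircases:
  assumes "finite L" "finite R"
  shows "card (staircases L R) = (card L + card R) choose card L"
  using assms
proof (induction "card L + card R" arbitrary: L R rule: less_induct)
  case less
  show ?case
  proof (cases "L = {} \<or> R = {}")
    case True
    then have "staircases L R = {{}}" by (auto simp: staircases_def)
    then show ?thesis using True by (elim disjE) simp_all
  next
    case False
    define l where "l = Max L"
    define r where "r = Max R"
    have lr: "l \<in> L" "r \<in> R" "\<And>x. x \<in> L \<Longrightarrow> x \<le> l" "\<And>x. x \<in> R \<Longrightarrow> x \<le> r"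
      using less.prems False by (simp_all add: l_def r_def)
    let ?f = "\<lambda>F. F \<union> {l} \<times> R"
    let ?A = "staircases (L - {l}) R" and ?B = "staircases L (R - {r})"
    have eq: "staircases L R = ?f ` ?A \<union> ?B"
    proof (intro equalityI subsetI)
      fix F assume F: "F \<in> staircases L R"
      then have sub: "F \<subseteq> L \<times> R"
        and D: "\<And>i j i' j'. (i, j) \<in> F \<Longrightarrow> i' \<in> L \<Longrightarrow> j' \<in> R \<Longrightarrow> i \<le> i' \<Longrightarrow> j' \<le> j \<Longrightarrow> (i', j') \<in> F"
        unfolding staircases_def by blast+
      show "F \<in> ?f ` ?A \<union> ?B"
      proof (cases "(l, r) \<in> F")
        case True
        then have row: "{l} \<times> R \<subseteq> F" using D lr by blast
        have "F - {l} \<times> R \<in> ?A"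
          using sub D unfolding staircases_def by blast
        moreover have "F = ?f (F - {l} \<times> R)" using row by blast
        ultimately show ?thesis by blast
      next
        case False
        then have "(i, r) \<notin> F" for i using D[of i r l r] lr sub by blast
        then have "F \<in> ?B" using sub D unfolding staircases_def by blast
        then show ?thesis by blast
      qed
    next
      fix F assume "F \<in> ?f ` ?A \<union> ?B"
      then show "F \<in> staircases L R"
      proof
        assume "F \<in> ?f ` ?A"
        then obtain G where G: "G \<in> ?A" "F = ?f G" by blast
        then have sub: "G \<subseteq> (L - {l}) \<times> R"
          and D: "\<And>i j i' j'. (i, j) \<in> G \<Longrightarrow> i' \<in> L - {l} \<Longrightarrow> j' \<in> R \<Longrightarrow> i \<le> i' \<Longrightarrow> j' \<le> j \<Longrightarrow> (i', j') \<in> G"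
          unfolding staircases_def by blast+
        have "(i', j') \<in> F" if "(i, j) \<in> F" "i' \<in> L" "j' \<in> R" "i \<le> i'" "j' \<le> j" for i j i' j'
        proof (cases "i' = l")
          case False
          with that lr(3)[of i'] have "i \<noteq> l" by auto
          with that G(2) have "(i, j) \<in> G" by auto
          with D[of i j i' j'] that False G(2) show ?thesis by auto
        qed (use that G(2) in auto)
        then show ?thesis using sub G(2) lr unfolding staircases_def by blast
      next
        assume "F \<in> ?B"
        then have sub: "F \<subseteq> L \<times> (R - {r})"
          and D: "\<And>i j i' j'. (i, j) \<in> F \<Longrightarrow> i' \<in> L \<Longrightarrow> j' \<in> R - {r} \<Longrightarrow> i \<le> i' \<Longrightarrow> j' \<le> j \<Longrightarrow> (i', j') \<in> F"
          unfolding staircases_def by blast+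
        have "(i', j') \<in> F" if "(i, j) \<in> F" "i' \<in> L" "j' \<in> R" "i \<le> i'" "j' \<le> j" for i j i' j'
        proof -
          have "j \<in> R - {r}" using sub that by blast
          then have "j' \<noteq> r" using lr(4)[of j] that by auto
          then show ?thesis using D that by blast
        qed
        then show ?thesis using sub unfolding staircases_def by blast
      qed
    qed
    have disj: "?f ` ?A \<inter> ?B = {}"
    proof -
      have "(l, r) \<in> ?f F" for F using lr by blast
      moreover have "(l, r) \<notin> F" if "F \<in> ?B" for F using that unfolding staircases_def by blast
      ultimately show ?thesis by blast
    qed
    obtain p q where pq: "card L = Suc p" "card R = Suc q"
      using False less.prems by (metis card_eq_0_iff not0_implies_Suc)
    have cards: "card (L - {l}) = p" "card (R - {r}) = q"
      using pq lr less.prems by auto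
    have "card (staircases L R) = card (?f ` ?A) + card ?B"
      unfolding eq by (rule card_Un_disjoint) (use less.prems disj in auto)
    also have "card (?f ` ?A) = card ?A"
      by (rule card_image) (auto simp: inj_on_def staircases_def)
    also have "card ?A = (p + Suc q) choose p"
      using less.hyps[of "L - {l}" R] less.prems cards pq by simp
    also have "card ?B = (Suc p + q) choose Suc p"
      using less.hyps[of L "R - {r}"] less.prems cards pq by simp
    finally show ?thesis by (simp add: pq)
  qed
qed

section \<open>Counting mixed graphs\<close>

text \<open>The power of 2 counts the graphs without edges between \<open>L\<close> and
  \<open>R\<close>, the binomial coefficient the staircases of such edges. The empty staircase would
  yield two cliques without cross edges, a graph that is already counted; hence the
  \<open>+ 1\<close> on the left.\<close>

lemma card_mixed_graphs:
  assumes fin: "finite L" "finite R" and ne: "L \<noteq> {}" "R \<noteq> {}"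
    and less: "\<And>l r. l \<in> L \<Longrightarrow> r \<in> R \<Longrightarrow> l < r"
  shows "card (mixed_graphs L R) + 1 =
    2 ^ (card L - 1 + (card R - 1)) + (card L + card R choose card L)"
proof -
  let ?sep = "\<lambda>(A, B). A \<union> B"
  \<comment> \<open>Both sides become cliques, and \<open>F\<close> lists the edges across.\<close>
  define join where "join F = pairs L \<union> pairs R \<union> (\<lambda>(i, j). {i, j}) ` F" for F
  let ?S = "mixed_graphs L {} \<times> mixed_graphs {} R" and ?J = "staircases L R - {{}}"
  have LR: "L \<inter> R = {}" using less by fastforce
  have join_iff: "{a, b} \<in> join F \<longleftrightarrow>
      a \<noteq> b \<and> (a \<in> L \<and> b \<in> L \<or> a \<in> R \<and> b \<in> R) \<or> (a, b) \<in> F \<or> (b, a) \<in> F" for a b F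
    by (force simp: join_def doubleton_eq_iff image_iff)
  have eq: "mixed_graphs L R = ?sep ` ?S \<union> join ` ?J"
  proof (intro equalityI subsetI)
    fix E assume "E \<in> mixed_graphs L R"
    note D = mixed_graphsD[OF this]
    define F where "F = {(i, j). i \<in> L \<and> j \<in> R \<and> {i, j} \<in> E}"
    have ends: "a \<in> L \<union> R" "b \<in> L \<union> R" "a \<noteq> b" if "{a, b} \<in> E" for a b
      using that D(1) by (meson pair_in_pairs subsetD)+
    show "E \<in> ?sep ` ?S \<union> join ` ?J"
    proof (cases "F = {}")
      case True
      have "E \<inter> pairs L \<in> mixed_graphs L {}"
        by (rule mixed_graphsI) (use D(2) in auto)
      moreover have "E \<inter> pairs R \<in> mixed_graphs {} R"
        by (rule mixed_graphsI) (use D(3) in auto)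
      moreover have "E = (E \<inter> pairs L) \<union> (E \<inter> pairs R)"
      proof (rule graph_eqI[OF D(1)])
        fix a b assume "a \<in> L \<union> R" "b \<in> L \<union> R" "a < b"
        then show "{a, b} \<in> E \<longleftrightarrow> {a, b} \<in> (E \<inter> pairs L) \<union> (E \<inter> pairs R)"
          using True less[of b a] unfolding F_def by auto
      qed (use D(1) in blast)
      ultimately show ?thesis by blast
    next
      case False
      then obtain l r where lr: "l \<in> L" "r \<in> R" "{l, r} \<in> E"
        unfolding F_def by auto
      define m where "m = Max L"
      define k where "k = Min R"
      have m: "m \<in> L" "\<And>x. x \<in> L \<Longrightarrow> x \<le> m"
        using fin ne by (simp_all add: m_def)
      have k: "k \<in> R" "\<And>x. x \<in> R \<Longrightarrow> k \<le> x"
        using fin ne by (simp_all add: k_def)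
      \<comment> \<open>A single cross edge makes \<open>L\<close> a clique: the final segment at
        \<open>r\<close> reaches up from \<open>l\<close> to \<open>m = Max L\<close>; the initial
        segment at \<open>m\<close> contains \<open>r\<close>, hence the rest of \<open>L\<close>;
        so the initial segment at any other vertex of \<open>L\<close> contains \<open>m\<close>,
        hence the rest of \<open>L\<close> as well.\<close>
      have "{m, r} \<in> E"
        using D(3)[of r m l] lr m(1) m(2)[OF lr(1)] less[OF m(1) lr(2)]
        by (cases "l = m") (auto simp: insert_commute)
      then have mL: "{m, x} \<in> E" if "x \<in> L" "x \<noteq> m" for x
        using D(2)[of m x r] m(1) that lr(2) less by blast
      have cliqueL: "{x, y} \<in> E" if "x \<in> L" "y \<in> L" "x \<noteq> y" for x y
        using D(2)[of x y m] mL[of x] mL[of y] m(2)[of y] that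
        by (cases "x = m"; cases "y = m") (auto simp: insert_commute)
      \<comment> \<open>The mirror image of the previous argument, with \<open>k = Min R\<close> in
        place of \<open>m\<close>.\<close>
      have "{l, k} \<in> E"
        using D(2)[of l k r] lr k(1) k(2)[OF lr(2)] less[OF lr(1) k(1)]
        by (cases "r = k") auto
      then have kR: "{k, x} \<in> E" if "x \<in> R" "x \<noteq> k" for x
        using D(3)[of k x l] k(1) that lr(1) less by (simp add: insert_commute)
      have cliqueR: "{x, y} \<in> E" if "x \<in> R" "y \<in> R" "x \<noteq> y" for x y
        using D(3)[of x y k] kR[of x] kR[of y] k(2)[of y] that
        by (cases "x = k"; cases "y = k") (auto simp: insert_commute)
      have "F \<in> ?J"
      proof -
        have "(i', j') \<in> F" if "(i, j) \<in> F" "i' \<in> L" "j' \<in> R" "i \<le> i'" "j' \<le> j" for i j i' j'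
        proof -
          have ij: "i \<in> L" "j \<in> R" "{i, j} \<in> E" using that(1) by (auto simp: F_def)
          have "{i, j'} \<in> E"
            using D(2)[of i j' j] ij that less[of i j'] by (cases "j = j'") auto
          then have "{i', j'} \<in> E"
            using D(3)[of j' i' i] ij that less[of i' j'] by (cases "i = i'") (auto simp: insert_commute)
          then show ?thesis using that by (simp add: F_def)
        qed
        moreover have "F \<subseteq> L \<times> R" by (auto simp: F_def)
        ultimately show ?thesis using False unfolding staircases_def by blast
      qed
      moreover have "E = join F"
      proof (rule graph_eqI[OF D(1)])
        show "join F \<subseteq> pairs (L \<union> R)"
          using LR pairs_mono[of L "L \<union> R"] pairs_mono[of R "L \<union> R"] by (auto simp: join_def F_def)
      next
        fix a b assume "a \<in> L \<union> R" "b \<in> L \<union> R" "a < b"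
        then show "{a, b} \<in> E \<longleftrightarrow> {a, b} \<in> join F"
          using cliqueL[of a b] cliqueR[of a b] less[of b a] LR
          unfolding join_iff F_def by (auto simp: insert_commute)
      qed
      ultimately show ?thesis by blast
    qed
  next
    fix E assume "E \<in> ?sep ` ?S \<union> join ` ?J"
    then show "E \<in> mixed_graphs L R"
    proof
      assume "E \<in> ?sep ` ?S"
      then obtain A B where AB: "A \<in> mixed_graphs L {}" "B \<in> mixed_graphs {} R" "E = A \<union> B"
        by auto
      note DA = mixed_graphsD[OF AB(1), simplified]
      note DB = mixed_graphsD[OF AB(2), simplified]
      have A: "a \<in> L \<and> b \<in> L" if "{a, b} \<in> A" for a b using DA(1) that by (meson pair_in_pairs subsetD)
      have B: "a \<in> R \<and> b \<in> R" if "{a, b} \<in> B" for a b using DB(1) that by (meson pair_in_pairs subsetD)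
      show ?thesis
      proof (rule mixed_graphsI)
        show "E \<subseteq> pairs (L \<union> R)"
          using AB(3) DA(1) DB(1) pairs_mono[of L "L \<union> R"] pairs_mono[of R "L \<union> R"] by auto
      next
        fix i x y assume *: "i \<in> L" "x \<in> L \<union> R" "x < y" "i \<noteq> x" "{i, y} \<in> E"
        then have "{i, y} \<in> A" using AB(3) B[of i y] LR by auto
        with * A[of i y] less[of y x] DA(2)[of i x y] AB(3) show "{i, x} \<in> E" by auto
      next
        fix i x y assume *: "i \<in> R" "y \<in> L \<union> R" "x < y" "i \<noteq> y" "{i, x} \<in> E"
        then have "{i, x} \<in> B" using AB(3) A[of i x] LR by auto
        with * B[of i x] less[of y x] DB(3)[of i y x] AB(3) show "{i, y} \<in> E" by auto
      qed
    next
      assume "E \<in> join ` ?J"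
      then obtain F where F: "E = join F" "F \<in> staircases L R" by blast
      have sub: "F \<subseteq> L \<times> R"
        and D: "\<And>i j i' j'. (i, j) \<in> F \<Longrightarrow> i' \<in> L \<Longrightarrow> j' \<in> R \<Longrightarrow> i \<le> i' \<Longrightarrow> j' \<le> j \<Longrightarrow> (i', j') \<in> F"
        using F(2) unfolding staircases_def by blast+
      have Fd: "a \<in> L" "b \<in> R" "a \<notin> R" "b \<notin> L" if "(a, b) \<in> F" for a b
        using that sub LR by blast+
      show ?thesis
      proof (rule mixed_graphsI)
        show "E \<subseteq> pairs (L \<union> R)"
          using sub LR pairs_mono[of L "L \<union> R"] pairs_mono[of R "L \<union> R"]
          unfolding F(1) join_def by force
      next
        fix i x y assume *: "i \<in> L" "x \<in> L \<union> R" "x < y" "i \<noteq> x" "{i, y} \<in> E"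
        show "{i, x} \<in> E"
        proof (cases "x \<in> L")
          case False
          then have x: "x \<in> R" using * by blast
          then have "y \<notin> L" using less[of y x] * by auto
          moreover have "i \<notin> R" using * LR by blast
          ultimately have "(i, y) \<in> F"
            using * Fd[of y i] unfolding F(1) join_iff by blast
          then have "(i, x) \<in> F" using D[of i y i x] * x by simp
          then show ?thesis unfolding F(1) join_iff by blast
        qed (use * in \<open>simp add: F(1) join_iff\<close>)
      next
        fix i x y assume *: "i \<in> R" "y \<in> L \<union> R" "x < y" "i \<noteq> y" "{i, x} \<in> E"
        show "{i, y} \<in> E"
        proof (cases "y \<in> R")
          case False
          then have y: "y \<in> L" using * by blast
          then have "x \<notin> R" using less[of y x] * by auto
          moreover have "i \<notin> L" using * LR by blast
          ultimately have "(x, i) \<in> F"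
            using * Fd[of i x] unfolding F(1) join_iff by blast
          then have "(y, i) \<in> F" using D[of x i y i] * y by simp
          then show ?thesis unfolding F(1) join_iff by blast
        qed (use * in \<open>simp add: F(1) join_iff\<close>)
      qed
    qed
  qed
  have dpairs: "pairs L \<inter> pairs R = {}"
  proof -
    have "pairs L \<inter> pairs R = pairs (L \<inter> R)" by (auto simp: pairs_def)
    also have "\<dots> = {}" unfolding LR by (auto elim: pairsE)
    finally show ?thesis .
  qed
  have inj_sep: "inj_on ?sep ?S"
  proof (rule inj_onI, clarify)
    fix A B A' B'
    assume "A \<in> mixed_graphs L {}" "B \<in> mixed_graphs {} R"
      "A' \<in> mixed_graphs L {}" "B' \<in> mixed_graphs {} R" and AB: "A \<union> B = A' \<union> B'"
    then have "A \<subseteq> pairs L" "A' \<subseteq> pairs L" "B \<subseteq> pairs R" "B' \<subseteq> pairs R"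
      using mixed_graphs_subset[of L "{}"] mixed_graphs_subset[of "{}" R] by auto
    with dpairs AB show "A = A' \<and> B = B'" by blast
  qed
  have inj_join: "inj_on join ?J"
  proof (rule inj_onI)
    fix F F' assume "F \<in> ?J" "F' \<in> ?J" and eq: "join F = join F'"
    then have sub: "F \<subseteq> L \<times> R" "F' \<subseteq> L \<times> R" by (auto simp: staircases_def)
    \<comment> \<open>As \<open>L\<close> and \<open>R\<close> are disjoint, the cliques contribute
      no cross edge, so a staircase can be read off from its join.\<close>
    have G: "G = {(a, b). a \<in> L \<and> b \<in> R \<and> {a, b} \<in> join G}" if "G \<subseteq> L \<times> R" for G
      using that LR unfolding join_iff by blast
    show "F = F'"
      by (subst G[OF sub(1)], subst G[OF sub(2)], subst eq) (rule refl)
  qed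
  have disj: "?sep ` ?S \<inter> join ` ?J = {}"
  proof (rule ccontr)
    assume "?sep ` ?S \<inter> join ` ?J \<noteq> {}"
    then obtain A B F where AB: "A \<in> mixed_graphs L {}" "B \<in> mixed_graphs {} R"
      and F: "F \<in> staircases L R" "F \<noteq> {}" "A \<union> B = join F"
      by auto
    then obtain i j where ij: "i \<in> L" "j \<in> R" "(i, j) \<in> F" unfolding staircases_def by blast
    then have "{i, j} \<in> A \<union> B" unfolding F(3) join_iff by blast
    moreover have "A \<subseteq> pairs L" "B \<subseteq> pairs R"
      using AB mixed_graphs_subset[of L "{}"] mixed_graphs_subset[of "{}" R] by auto
    ultimately have "{i, j} \<in> pairs L \<union> pairs R" by blast
    then show False using ij LR by auto
  qed
  have "card (mixed_graphs L R) = card (?sep ` ?S) + card (join ` ?J)"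
    unfolding eq by (rule card_Un_disjoint) (use fin disj in auto)
  also have "card (?sep ` ?S) = 2 ^ (card L - 1 + (card R - 1))"
    using card_image[OF inj_sep] card_initial_graphs[of L] card_final_graphs[of R] fin ne
    by (simp add: card_cartesian_product power_add)
  also have "card (join ` ?J) = card (staircases L R) - 1"
    using card_image[OF inj_join] by (simp add: staircases_def)
  finally have "card (mixed_graphs L R) = 2 ^ (card L - 1 + (card R - 1)) + (card (staircases L R) - 1)" .
  moreover have "card (staircases L R) > 0"
    using fin by (auto simp: card_gt_0_iff staircases_def)
  ultimately show ?thesis using card_staircases[OF fin] by simp
qed

section \<open>Graphs in which every neighbourhood is a segment\<close>

text \<open>Adjacency to \<open>i\<close>, read along the other vertices in increasing order,
  changes at most once. This is the same as the neighbourhood of \<open>i\<close> being an initial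
  or a final segment, stated without choosing which of the two.\<close>

definition segment_graphs :: "nat \<Rightarrow> nat set set set" where
  "segment_graphs n = {E. E \<subseteq> pairs {1..n} \<and>
     (\<forall>i \<in> {1..n}. \<forall>x \<in> {1..n}. \<forall>y \<in> {1..n}. \<forall>z \<in> {1..n}. x < y \<and> y < z \<and> i \<notin> {x, y, z} \<longrightarrow>
        ({i, x} \<in> E \<longleftrightarrow> {i, z} \<in> E) \<longrightarrow> ({i, y} \<in> E \<longleftrightarrow> {i, z} \<in> E))}"

lemma segment_graphsD:
  assumes "E \<in> segment_graphs n"
  shows "E \<subseteq> pairs {1..n}"
    and "\<lbrakk>i \<in> {1..n}; x \<in> {1..n}; z \<in> {1..n}; x < y; y < z; i \<noteq> x; i \<noteq> y; i \<noteq> z;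
      {i, x} \<in> E \<longleftrightarrow> {i, z} \<in> E\<rbrakk> \<Longrightarrow> {i, y} \<in> E \<longleftrightarrow> {i, z} \<in> E"
proof -
  show "E \<subseteq> pairs {1..n}" using assms by (simp add: segment_graphs_def)
  assume "i \<in> {1..n}" "x \<in> {1..n}" "z \<in> {1..n}" "x < y" "y < z" "i \<noteq> x" "i \<noteq> y" "i \<noteq> z"
    "{i, x} \<in> E \<longleftrightarrow> {i, z} \<in> E"
  moreover from this have "y \<in> {1..n}" by simp
  ultimately show "{i, y} \<in> E \<longleftrightarrow> {i, z} \<in> E"
    using assms unfolding segment_graphs_def by blast
qed

lemma finite_segment_graphs [simp]: "finite (segment_graphs n)"
  by (rule finite_subset[of _ "Pow (pairs {1..n})"]) (auto simp: segment_graphs_def)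

lemma compl_segment_graphs:
  assumes "E \<in> segment_graphs n"
  shows "pairs {1..n} - E \<in> segment_graphs n"
  using assms unfolding segment_graphs_def by auto

text \<open>As the neighbourhood of 1 omits \<open>n\<close>, it is an initial segment
  \<open>{2..a}\<close>. For every other \<open>i\<close>, vertex 1 is the least possible neighbour,
  so the segment at \<open>i\<close> is initial if it contains 1, that is if
  \<open>i \<le> a\<close>, and final otherwise.\<close>

lemma segment_graphs_nonadjacent_ends:
  assumes "n \<ge> 2"
  shows "{E \<in> segment_graphs n. {1, n} \<notin> E} =
    (\<Union>a \<in> {1..<n}. (\<lambda>E. E \<union> star 1 {2..a}) ` mixed_graphs {2..a} {Suc a..n})"
proof (intro equalityI subsetI)
  fix E assume "E \<in> {E \<in> segment_graphs n. {1, n} \<notin> E}"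
  then have E: "E \<in> segment_graphs n" and n: "{1, n} \<notin> E" by auto
  note D = segment_graphsD[OF E]
  define S where "S = {x. {1, x} \<in> E}"
  have S: "S \<subseteq> {2..<n}"
  proof
    fix x assume "x \<in> S"
    then have "{1, x} \<in> E" by (simp add: S_def)
    moreover from this have "x \<in> {1..n}" "x \<noteq> 1"
      using D(1) by (meson pair_in_pairs subsetD)+
    moreover have "x \<noteq> n" using n calculation(1) by auto
    ultimately show "x \<in> {2..<n}" by auto
  qed
  then have "finite S" by (rule finite_subset) simp
  have down: "x \<in> S" if "y \<in> S" "x < y" "2 \<le> x" for x y
  proof (rule ccontr)
    assume "x \<notin> S"
    moreover have "y < n" "2 \<le> y" using S that(1) by auto
    ultimately show False
      using D(2)[of 1 x n y] that n assms by (auto simp: S_def)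
  qed
  \<comment> \<open>The inserted 1 is the value for an isolated vertex 1; then \<open>{2..a}\<close>
    is empty.\<close>
  define a where "a = Max (insert 1 S)"
  have "a \<in> insert 1 S" unfolding a_def by (rule Max_in) (use \<open>finite S\<close> in auto)
  then have a: "a \<in> {1..<n}" using S assms by auto
  have aS: "S = {2..a}"
  proof (intro equalityI subsetI)
    fix x assume "x \<in> S"
    then show "x \<in> {2..a}" using S \<open>finite S\<close> by (auto simp: a_def)
  next
    fix x assume "x \<in> {2..a}"
    then show "x \<in> S" using \<open>a \<in> insert 1 S\<close> down[of a x] by (cases "x = a") auto
  qed
  then have N1: "{1, x} \<in> E \<longleftrightarrow> 2 \<le> x \<and> x \<le> a" for x
    by (auto simp: S_def)
  have U: "{2..a} \<union> {Suc a..n} = {2..n}" using a by auto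
  have "E \<inter> pairs {2..n} \<in> mixed_graphs {2..a} {Suc a..n}"
  proof (rule mixed_graphsI, goal_cases)
    case 1
    then show ?case unfolding U by simp
  next
    case (2 i x y)
    have "{i, 1} \<in> E" using N1[of i] 2 by (simp add: insert_commute)
    with 2 a show ?case
      unfolding U using D(2)[of i 1 y x] by auto
  next
    case (3 i x y)
    have "{i, 1} \<notin> E" using N1[of i] 3 by (simp add: insert_commute)
    with 3 a show ?case
      unfolding U using D(2)[of i 1 y x] by auto
  qed
  moreover have "E = E \<inter> pairs {2..n} \<union> star 1 {2..a}"
  proof (rule graph_eqI[OF D(1)])
    show "E \<inter> pairs {2..n} \<union> star 1 {2..a} \<subseteq> pairs {1..n}"
      using D(1) a by (auto simp: star_def)
  next
    fix x y assume "x \<in> {1..n}" "y \<in> {1..n}" "x < y"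
    then show "{x, y} \<in> E \<longleftrightarrow> {x, y} \<in> E \<inter> pairs {2..n} \<union> star 1 {2..a}"
      using N1[of y] by (cases "x = 1") (auto simp: pair_in_star)
  qed
  ultimately show "E \<in> (\<Union>a \<in> {1..<n}. (\<lambda>E. E \<union> star 1 {2..a}) ` mixed_graphs {2..a} {Suc a..n})"
    using a by blast
next
  fix E assume "E \<in> (\<Union>a \<in> {1..<n}. (\<lambda>E. E \<union> star 1 {2..a}) ` mixed_graphs {2..a} {Suc a..n})"
  then obtain a F where a: "1 \<le> a" "a < n" and F: "F \<in> mixed_graphs {2..a} {Suc a..n}"
    and E: "E = F \<union> star 1 {2..a}"
    by auto
  have U: "{2..a} \<union> {Suc a..n} = {2..n}" using a by auto
  note D = mixed_graphsD[OF F, unfolded U]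
  have N1: "{1, x} \<in> E \<longleftrightarrow> 2 \<le> x \<and> x \<le> a" for x
  proof -
    have "{1, x} \<notin> F" using D(1) by fastforce
    then show ?thesis unfolding E by (auto simp: pair_in_star)
  qed
  have N: "{i, x} \<in> E \<longleftrightarrow> {i, x} \<in> F" if "i \<noteq> 1" "x \<noteq> 1" for i x
    using that unfolding E by (auto simp: pair_in_star)
  have sub: "E \<subseteq> pairs {1..n}"
    using D(1) pairs_mono[of "{2..n}" "{1..n}"] a unfolding E by (auto simp: star_def)
  have "{i, y} \<in> E \<longleftrightarrow> {i, z} \<in> E"
    if V: "i \<in> {1..n}" "x \<in> {1..n}" "y \<in> {1..n}" "z \<in> {1..n}"
      and *: "x < y" "y < z" "i \<notin> {x, y, z}" "{i, x} \<in> E \<longleftrightarrow> {i, z} \<in> E" for i x y z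
  proof (cases "i = 1")
    case True
    with that N1[of x] N1[of y] N1[of z] show ?thesis by auto
  next
    case i: False
    have y: "{i, y} \<in> E \<longleftrightarrow> {i, y} \<in> F" "{i, z} \<in> E \<longleftrightarrow> {i, z} \<in> F"
      using N[of i y] N[of i z] that i by auto
    \<comment> \<open>Of the three vertices \<open>x < y < z\<close> only \<open>x\<close> can be 1,
      and only then does the star matter.\<close>
    have x: "{i, x} \<in> E \<longleftrightarrow> (if x = 1 then i \<le> a else {i, x} \<in> F)"
      using N[of i x] N1[of i] i V by (auto simp: insert_commute)
    show ?thesis
    proof (cases "i \<le> a")
      case True
      then have "i \<in> {2..a}" using i V by auto
      then show ?thesis
        using D(2)[of i y z] D(2)[of i x y] that x y by (auto split: if_splits)
    next
      case False
      then have "i \<in> {Suc a..n}" using V by auto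
      then show ?thesis
        using D(3)[of i z y] D(3)[of i y x] that x y False by (auto split: if_splits)
    qed
  qed
  then have "E \<in> segment_graphs n"
    using sub unfolding segment_graphs_def by blast
  then show "E \<in> {E \<in> segment_graphs n. {1, n} \<notin> E}"
    using N1[of n] a by simp
qed

text \<open>Complementation toggles the edge \<open>{1, n}\<close>, so the total is twice the sum,
  over the neighbourhoods \<open>{2..a}\<close> of vertex 1, of the numbers of mixed graphs on the
  remaining vertices.\<close>

lemma card_segment_graphs:
  assumes "n \<ge> 4"
  shows "int (card (segment_graphs n)) = 2 ^ n + int n * 2 ^ (n - 2) - 2 * int n"
proof -
  \<comment> \<open>For \<open>a \<ge> 2\<close> the exponent \<open>(a - 2) + (n - a - 1)\<close>
    equals \<open>m\<close>, whatever \<open>a\<close> is.\<close>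
  define m where "m = n - 3"
  have m: "n = m + 3" using assms by (simp add: m_def)
  let ?N = "{E \<in> segment_graphs n. {1, n} \<notin> E}" and ?Y = "{E \<in> segment_graphs n. {1, n} \<in> E}"
  let ?c = "\<lambda>E. pairs {1..n} - E"
  have "bij_betw ?c ?N ?Y"
  proof (rule bij_betw_byWitness[where f' = ?c])
    show "?c ` ?N \<subseteq> ?Y" "?c ` ?Y \<subseteq> ?N"
      using assms compl_segment_graphs[of _ n] by auto
  qed (use segment_graphsD(1) in blast)+
  then have "card ?N = card ?Y" by (rule bij_betw_same_card)
  moreover have "card (segment_graphs n) = card (?N \<union> ?Y)"
    by (rule arg_cong[of _ _ card]) auto
  moreover have "card (?N \<union> ?Y) = card ?N + card ?Y"
    by (rule card_Un_disjoint) auto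
  ultimately have double: "card (segment_graphs n) = 2 * card ?N" by simp
  let ?f = "\<lambda>a E. E \<union> star 1 {2..a}" and ?M = "\<lambda>a. mixed_graphs {2..a} {Suc a..n}"
  have sub: "?M a \<subseteq> Pow (pairs {2..n})" if "a \<in> {1..<n}" for a
  proof -
    have "{2..a} \<union> {Suc a..n} = {2..n}" using that by auto
    then show ?thesis using mixed_graphs_subset[of "{2..a}" "{Suc a..n}"] by simp
  qed
  \<comment> \<open>The neighbourhood of 1 reveals \<open>a\<close>, so the union is
    disjoint.\<close>
  have nbr: "{x. {1, x} \<in> E} = {2..a}" if "E \<in> ?f a ` ?M a" "a \<in> {1..<n}" for a E
  proof -
    from that(1) obtain F where F: "F \<in> ?M a" "E = ?f a F" by blast
    have "{1, x} \<notin> pairs {2..n}" for x by simp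
    then have "{1, x} \<notin> F" for x using F(1) sub[OF that(2)] by blast
    then show ?thesis unfolding F(2) by (auto simp: pair_in_star)
  qed
  have "n \<ge> 2" using assms by simp
  note ends = segment_graphs_nonadjacent_ends[OF this]
  have "card ?N = (\<Sum>a \<in> {1..<n}. card (?f a ` ?M a))"
    unfolding ends
  proof (rule card_UN_disjoint)
    show "\<forall>a \<in> {1..<n}. \<forall>b \<in> {1..<n}. a \<noteq> b \<longrightarrow> ?f a ` ?M a \<inter> ?f b ` ?M b = {}"
    proof (intro ballI impI)
      fix a b assume ab: "a \<in> {1..<n}" "b \<in> {1..<n}" "a \<noteq> b"
      show "?f a ` ?M a \<inter> ?f b ` ?M b = {}"
      proof (rule ccontr)
        assume "?f a ` ?M a \<inter> ?f b ` ?M b \<noteq> {}"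
        then obtain E where "E \<in> ?f a ` ?M a" "E \<in> ?f b ` ?M b" by blast
        then have "{2..a} = {2..b}" using nbr[of E a] nbr[of E b] ab by simp
        then have "card {2..a} = card {2..b}" by (rule arg_cong)
        then have "a - 1 = b - 1" by simp
        moreover have "1 \<le> a" "1 \<le> b" using ab by simp_all
        ultimately show False using ab(3) by linarith
      qed
    qed
    show "finite {1..<n}" by (rule finite_atLeastLessThan)
    show "\<forall>a \<in> {1..<n}. finite (?f a ` ?M a)"
      by (intro ballI finite_imageI finite_mixed_graphs finite_atLeastAtMost)
  qed
  also have "\<dots> = (\<Sum>a \<in> {1..<n}. card (?M a))"
  proof (rule sum.cong[OF refl], rule card_image)
    fix a assume "a \<in> {1..<n}"
    show "inj_on (?f a) (?M a)"
      by (rule inj_on_subset[OF inj_on_Un_star sub]) (simp, rule \<open>a \<in> {1..<n}\<close>)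
  qed
  also have "{1..<n} = insert 1 {2..<n}" using assms by auto
  also have "(\<Sum>a \<in> insert 1 {2..<n}. card (?M a)) = card (?M 1) + (\<Sum>a \<in> {2..<n}. card (?M a))"
    by (rule sum.insert) auto
  \<comment> \<open>Here \<open>{2..1}\<close> is empty, a case outside
    \<open>card_mixed_graphs\<close>: all neighbourhoods are final.\<close>
  also have "card (?M 1) = 2 ^ (m + 1)"
    using card_final_graphs[of "{2..n}"] assms by (simp add: m numeral_2_eq_2)
  finally have N: "card ?N = 2 ^ (m + 1) + (\<Sum>a \<in> {2..<n}. card (?M a))" .
  have "card (?M a) + 1 = 2 ^ m + (n - 1 choose (a - 1))" if "a \<in> {2..<n}" for a
  proof -
    have "card (?M a) + 1 = 2 ^ (card {2..a} - 1 + (card {Suc a..n} - 1)) +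
        (card {2..a} + card {Suc a..n} choose card {2..a})"
      by (rule card_mixed_graphs) (use that in auto)
    moreover have "card {2..a} = a - 1" "card {Suc a..n} = n - a" by simp_all
    moreover have "a - 1 - 1 + (n - a - 1) = m" "a - 1 + (n - a) = n - 1" using that m by auto
    ultimately show ?thesis by metis
  qed
  then have "(\<Sum>a \<in> {2..<n}. card (?M a) + 1) = (\<Sum>a \<in> {2..<n}. 2 ^ m + (n - 1 choose (a - 1)))"
    by simp
  then have "(\<Sum>a \<in> {2..<n}. card (?M a)) + (m + 1) =
      (m + 1) * 2 ^ m + (\<Sum>a \<in> {2..<n}. n - 1 choose (a - 1))"
    by (simp only: sum.distrib sum_constant) (simp add: m)
  \<comment> \<open>Row \<open>n - 1\<close> of Pascal's triangle without its two outer
    ones.\<close>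
  moreover have "(\<Sum>a \<in> {2..<n}. n - 1 choose (a - 1)) + 2 = 2 ^ (m + 2)"
  proof -
    have "(\<Sum>a \<in> {2..<n}. n - 1 choose (a - 1)) = (\<Sum>j \<in> {1..<n - 1}. n - 1 choose j)"
      by (rule sum.reindex_bij_witness[of _ Suc "\<lambda>a. a - 1"]) auto
    moreover have "2 ^ (n - 1) = (\<Sum>j \<in> {1..<n - 1}. n - 1 choose j) + 2"
    proof -
      have "2 ^ (n - 1) = (\<Sum>j \<le> n - 1. n - 1 choose j)"
        by (simp only: choose_row_sum)
      also have "{..n - 1} = insert 0 (insert (n - 1) {1..<n - 1})" using assms by auto
      also have "(\<Sum>j \<in> \<dots>. n - 1 choose j) = (\<Sum>j \<in> {1..<n - 1}. n - 1 choose j) + 2"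
        using assms by simp
      finally show ?thesis .
    qed
    moreover have "n - 1 = m + 2" using m by simp
    ultimately show ?thesis by metis
  qed
  \<comment> \<open>The term \<open>m + 3\<close> gathers one unit for each of the
    \<open>m + 1\<close> values of \<open>a\<close> and the two outer binomial coefficients, so that
    no natural subtraction occurs.\<close>
  ultimately have N': "card ?N + (m + 3) = 2 ^ (m + 1) + (m + 1) * 2 ^ m + 2 ^ (m + 2)"
    using N by linarith
  have "card (segment_graphs n) + 2 * (m + 3) = 2 * (card ?N + (m + 3))"
    unfolding double by (rule distrib_left[symmetric])
  also have "\<dots> = 2 * (2 ^ (m + 1) + (m + 1) * 2 ^ m + 2 ^ (m + 2))"
    unfolding N' ..
  also have "\<dots> = 2 ^ (m + 3) + (m + 3) * 2 ^ (m + 1)"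
    by (simp add: power_add algebra_simps)
  finally have "card (segment_graphs n) + 2 * n = 2 ^ n + n * 2 ^ (n - 2)"
    by (simp add: m)
  then have "int (card (segment_graphs n) + 2 * n) = int (2 ^ n + n * 2 ^ (n - 2))"
    by (rule arg_cong)
  then show ?thesis by simp
qed

section \<open>Relative order and commutation classes\<close>

primrec before :: "'a list \<Rightarrow> 'a \<Rightarrow> 'a \<Rightarrow> bool" where
  "before [] x y \<longleftrightarrow> False"
| "before (z # zs) x y \<longleftrightarrow> z = x \<and> y \<in> set zs \<or> before zs x y"

lemma before_append: "before (xs @ ys) x y \<longleftrightarrow>
    before xs x y \<or> before ys x y \<or> x \<in> set xs \<and> y \<in> set ys"
  by (induction xs) auto

lemma before_in_set: "before xs x y \<Longrightarrow> x \<in> set xs \<and> y \<in> set xs"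
  by (induction xs) auto

lemma before_filter: "before (filter Q xs) x y \<longleftrightarrow> Q x \<and> Q y \<and> before xs x y"
  by (induction xs) (auto dest: before_in_set)

lemma sorted_wrt_iff_before: "sorted_wrt P xs \<longleftrightarrow> (\<forall>x y. before xs x y \<longrightarrow> P x y)"
  by (induction xs) auto

lemma before_total: "x \<in> set xs \<Longrightarrow> y \<in> set xs \<Longrightarrow> x \<noteq> y \<Longrightarrow> before xs x y \<or> before xs y x"
  by (induction xs) auto

lemma before_asym: "distinct xs \<Longrightarrow> before xs x y \<Longrightarrow> \<not> before xs y x"
  by (induction xs) (auto dest: before_in_set)

lemma before_trans: "distinct xs \<Longrightarrow> before xs x y \<Longrightarrow> before xs y z \<Longrightarrow> before xs x z"
  by (induction xs) (auto dest: before_in_set)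

section \<open>Commutation classes and the order of non-commuting elements\<close>

lemma commutation_moves_Cons:
  "(xs, ys) \<in> commutation_moves\<^sup>* \<Longrightarrow> (z # xs, z # ys) \<in> commutation_moves\<^sup>*"
proof (induction rule: rtrancl_induct)
  case (step ys zs)
  then obtain us X Y vs where "ys = us @ [X, Y] @ vs" "zs = us @ [Y, X] @ vs" "commute X Y"
    by (auto simp: commutation_moves_def)
  then have "(z # ys, z # zs) \<in> commutation_moves"
    unfolding commutation_moves_def by (metis (mono_tags, lifting) CollectI append_Cons)
  with step.IH show ?case by (rule rtrancl_into_rtrancl)
qed simp

lemma commutation_moves_to_front:
  assumes "\<And>u. u \<in> set us \<Longrightarrow> commute u x"
  shows "(us @ x # vs, x # us @ vs) \<in> commutation_moves\<^sup>*"
  using assms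
proof (induction us)
  case (Cons u us)
  then have "(u # us @ x # vs, u # x # us @ vs) \<in> commutation_moves\<^sup>*"
    by (intro commutation_moves_Cons) simp
  moreover have "([] @ [u, x] @ (us @ vs), [] @ [x, u] @ (us @ vs)) \<in> commutation_moves"
    unfolding commutation_moves_def using Cons.prems[of u] by fastforce
  ultimately show ?case by (simp add: rtrancl_into_rtrancl)
qed simp

text \<open>In \<open>ys\<close>, everything in front of the head \<open>x\<close> of
  \<open>xs\<close> commutes with \<open>x\<close>, since a non-commuting element would have to
  follow \<open>x\<close> in both lists. So \<open>x\<close> can be moved to the front, and the
  tails are handled by induction.\<close>

lemma commutation_moves_if_before:
  assumes "distinct xs" "distinct ys" "set xs = set ys"
    and "\<And>x y. before xs x y \<Longrightarrow> \<not> commute x y \<Longrightarrow> before ys x y"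
  shows "(ys, xs) \<in> commutation_moves\<^sup>*"
  using assms
proof (induction xs arbitrary: ys)
  case (Cons x xs)
  then obtain us vs where ys: "ys = us @ x # vs"
    by (metis list.set_intros(1) split_list)
  have "commute u x" if "u \<in> set us" for u
  proof (rule ccontr)
    assume "\<not> commute u x"
    then have "\<not> commute x u" by (simp add: commute_def Int_commute)
    moreover have "before (x # xs) x u"
    proof -
      have "u \<in> set (x # xs)" using that Cons.prems(3) ys by simp
      moreover have "u \<noteq> x" using that Cons.prems(2) ys by auto
      ultimately show ?thesis by simp
    qed
    ultimately have "before ys x u" by (rule Cons.prems(4)[rotated])
    moreover have "before ys u x" using that ys by (simp add: before_append)
    ultimately show False using Cons.prems(2) before_asym by metis
  qed
  then have "(ys, x # us @ vs) \<in> commutation_moves\<^sup>*"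
    unfolding ys by (rule commutation_moves_to_front)
  moreover have "(us @ vs, xs) \<in> commutation_moves\<^sup>*"
  proof (rule Cons.IH)
    show "distinct xs" "distinct (us @ vs)"
      using Cons.prems(1,2) ys by auto
    show "set xs = set (us @ vs)"
      using Cons.prems(1-3) ys insert_ident[of x "set xs" "set us \<union> set vs"] by auto
    fix a b assume *: "before xs a b" "\<not> commute a b"
    then have "before ys a b" using Cons.prems(4)[of a b] by simp
    moreover have "a \<noteq> x" "b \<noteq> x" using before_in_set[OF *(1)] Cons.prems(1) by auto
    ultimately show "before (us @ vs) a b" by (auto simp: ys before_append)
  qed
  ultimately show ?case
    by (meson commutation_moves_Cons rtrancl_trans)
qed simp

text \<open>A move reverses only one pair, and that pair commutes.\<close>

lemma before_if_commutation_moves: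
  assumes "(xs, ys) \<in> commutation_moves\<^sup>*" "before xs x y" "\<not> commute x y"
  shows "before ys x y"
  using assms
  by (induction rule: rtrancl_induct) (auto simp: commutation_moves_def before_append)

section \<open>Lex order on packets\<close>

lemma sorted_list_of_set_split:
  fixes X :: "nat set"
  assumes "finite X"
  shows "sorted_list_of_set X =
    sorted_list_of_set {z \<in> X. z < x} @ sorted_list_of_set {z \<in> X. x \<le> z}"
proof (rule sorted_distinct_set_unique)
  show "set (sorted_list_of_set X) =
      set (sorted_list_of_set {z \<in> X. z < x} @ sorted_list_of_set {z \<in> X. x \<le> z})"
    using assms by auto
qed (use assms in \<open>auto simp: sorted_append\<close>)

text \<open>Both increasing sequences agree below \<open>x\<close>. The next entry is
  \<open>x\<close> itself when \<open>y\<close> is deleted, and something larger when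
  \<open>x\<close> is deleted.\<close>

lemma lex_less_packet:
  assumes "finite X" "x \<in> X" "y \<in> X" "x < y"
  shows "lex_less (X - {y}) (X - {x})"
proof -
  let ?U = "{z \<in> X - {y}. x \<le> z}" and ?V = "{z \<in> X - {x}. x \<le> z}"
  have init: "{z \<in> X - {y}. z < x} = {z \<in> X - {x}. z < x}" using assms(4) by auto
  have V: "finite ?V" "?V \<noteq> {}" using assms by auto
  then have "x < Min ?V" using Min_in[of ?V] by auto
  moreover have "Min ?U = x" by (rule Min_eqI) (use assms in auto)
  ultimately have less: "Min ?U < Min ?V" by argo
  have U: "finite ?U" "?U \<noteq> {}" using assms by auto
  have "(sorted_list_of_set ?U, sorted_list_of_set ?V) \<in> lexord {(a, b). a < b}"
    unfolding sorted_list_of_set_nonempty[OF U] sorted_list_of_set_nonempty[OF V] lexord_cons_cons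
    using less by blast
  then have "(sorted_list_of_set {z \<in> X - {y}. z < x} @ sorted_list_of_set ?U,
      sorted_list_of_set {z \<in> X - {x}. z < x} @ sorted_list_of_set ?V) \<in> lexord {(a, b). a < b}"
    unfolding init by (rule lexord_append_leftI)
  then show ?thesis
    unfolding lex_less_def using assms(1)
    by (simp add: sorted_list_of_set_split[of "X - {y}" x] sorted_list_of_set_split[of "X - {x}" x])
qed

lemma lex_less_asym: "lex_less X Y \<Longrightarrow> \<not> lex_less Y X"
proof
  assume "lex_less X Y" "lex_less Y X"
  then have "lex_less X X"
    unfolding lex_less_def by (rule lexord_trans) (auto simp: trans_def)
  moreover have "(sorted_list_of_set X, sorted_list_of_set X) \<notin> lexord {(a, b). a < b}"
    by (rule lexord_irreflexive) simp
  ultimately show False unfolding lex_less_def by contradiction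
qed

lemma lex_less_packet_iff:
  assumes "finite X" "x \<in> X" "y \<in> X" "x \<noteq> y"
  shows "lex_less (X - {x}) (X - {y}) \<longleftrightarrow> y < x"
  using assms lex_less_packet[of X] lex_less_asym by (metis linorder_neqE_nat)

text \<open>Lex order deletes larger elements first, antilex order smaller ones. As the list is
  total on each packet, sortedness, which derives comparisons from positions, can be turned into a
  rule deriving positions from comparisons.\<close>

lemma admissible_orders_iff:
  assumes "\<rho> \<in> total_orders (ksubsets n k)"
  shows "\<rho> \<in> admissible_orders n k \<longleftrightarrow> (\<forall>X \<in> ksubsets n (k + 1).
    (\<forall>x \<in> X. \<forall>y \<in> X. x < y \<longrightarrow> before \<rho> (X - {y}) (X - {x})) \<or>
    (\<forall>x \<in> X. \<forall>y \<in> X. x < y \<longrightarrow> before \<rho> (X - {x}) (X - {y})))"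
proof -
  have dist: "distinct \<rho>" and set: "set \<rho> = ksubsets n k"
    using assms by (auto simp: total_orders_def)
  have "sorted_wrt lex_less (restrict_order \<rho> (packet X)) \<longleftrightarrow>
      (\<forall>x \<in> X. \<forall>y \<in> X. x < y \<longrightarrow> before \<rho> (X - {y}) (X - {x}))" (is "?L \<longleftrightarrow> ?L'")
    "sorted_wrt antilex_less (restrict_order \<rho> (packet X)) \<longleftrightarrow>
      (\<forall>x \<in> X. \<forall>y \<in> X. x < y \<longrightarrow> before \<rho> (X - {x}) (X - {y}))" (is "?A \<longleftrightarrow> ?A'")
    if X: "X \<in> ksubsets n (k + 1)" for X
  proof -
    have fin: "finite X" using X by (auto simp: ksubsets_def intro: finite_subset)
    have total: "before \<rho> (X - {x}) (X - {y}) \<longleftrightarrow> \<not> before \<rho> (X - {y}) (X - {x})"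
      if "x \<in> X" "y \<in> X" "x \<noteq> y" for x y
    proof -
      have "X - {x} \<in> set \<rho>" "X - {y} \<in> set \<rho>" "X - {x} \<noteq> X - {y}"
        using that X by (auto simp: set ksubsets_def)
      then show ?thesis using dist before_total before_asym by metis
    qed
    have sorted: "sorted_wrt P (restrict_order \<rho> (packet X)) \<longleftrightarrow>
        (\<forall>x \<in> X. \<forall>y \<in> X. before \<rho> (X - {x}) (X - {y}) \<longrightarrow> P (X - {x}) (X - {y}))" for P
      unfolding restrict_order_def sorted_wrt_iff_before before_filter packet_def by blast
    have irrefl: "\<not> before \<rho> K K" for K
      using before_asym[OF dist] by blast
    have ne: "x \<noteq> y" if "before \<rho> (X - {x}) (X - {y})" for x y
      using that irrefl by auto
    have "?L \<longleftrightarrow> (\<forall>x \<in> X. \<forall>y \<in> X. before \<rho> (X - {x}) (X - {y}) \<longrightarrow> y < x)"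
      unfolding sorted using ne lex_less_packet_iff[OF fin] by blast
    also have "\<dots> \<longleftrightarrow> ?L'"
      using total ne by (metis linorder_neqE_nat order_less_asym)
    finally show "?L \<longleftrightarrow> ?L'" .
    have "?A \<longleftrightarrow> (\<forall>x \<in> X. \<forall>y \<in> X. before \<rho> (X - {x}) (X - {y}) \<longrightarrow> x < y)"
      unfolding sorted antilex_less_def using ne lex_less_packet_iff[OF fin] by blast
    also have "\<dots> \<longleftrightarrow> ?A'"
      using total ne by (metis linorder_neqE_nat order_less_asym)
    finally show "?A \<longleftrightarrow> ?A'" .
  qed
  then show ?thesis
    by (simp add: admissible_orders_def assms)
qed

section \<open>Inversion graphs\<close>

text \<open>The inversion set of the order, that is the index sets \<open>X\<close> with packet in
  antilex order, each recorded by its complement \<open>e\<close>.\<close>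

definition inversion_graph :: "nat \<Rightarrow> nat set list \<Rightarrow> nat set set" where
  "inversion_graph n \<rho> = {e \<in> pairs {1..n}. \<forall>x \<in> {1..n} - e. \<forall>y \<in> {1..n} - e.
     x < y \<longrightarrow> before \<rho> ({1..n} - e - {x}) ({1..n} - e - {y})}"

lemma compl_pair_ksubsets:
  assumes "e \<in> pairs {1..n}" "n \<ge> 3"
  shows "{1..n} - e \<in> ksubsets n (n - 3 + 1)"
  using assms by (auto simp: pairs_def ksubsets_def card_Diff_subset finite_subset)

text \<open>Admissibility leaves only two orders for a packet, so a single bit fixes all comparisons
  in it.\<close>

lemma inversion_graph_iff:
  assumes \<rho>: "\<rho> \<in> admissible_orders n (n - 3)" and n: "n \<ge> 3" and e: "e \<in> pairs {1..n}"
    and xy: "x \<in> {1..n} - e" "y \<in> {1..n} - e" "x \<noteq> y"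
  shows "before \<rho> ({1..n} - e - {x}) ({1..n} - e - {y}) \<longleftrightarrow> (e \<in> inversion_graph n \<rho> \<longleftrightarrow> x < y)"
proof -
  let ?X = "{1..n} - e"
  have tot: "\<rho> \<in> total_orders (ksubsets n (n - 3))"
    using \<rho> by (simp add: admissible_orders_def)
  then have asym: "before \<rho> K K' \<Longrightarrow> \<not> before \<rho> K' K" for K K'
    by (simp add: total_orders_def before_asym)
  have "(\<forall>x \<in> ?X. \<forall>y \<in> ?X. x < y \<longrightarrow> before \<rho> (?X - {y}) (?X - {x})) \<or>
      (\<forall>x \<in> ?X. \<forall>y \<in> ?X. x < y \<longrightarrow> before \<rho> (?X - {x}) (?X - {y}))"
    using \<rho> admissible_orders_iff[OF tot] compl_pair_ksubsets[OF e n] by blast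
  then show ?thesis
  proof
    assume *: "\<forall>x \<in> ?X. \<forall>y \<in> ?X. x < y \<longrightarrow> before \<rho> (?X - {y}) (?X - {x})"
    have "e \<notin> inversion_graph n \<rho>"
    proof
      assume "e \<in> inversion_graph n \<rho>"
      then have "\<forall>x \<in> ?X. \<forall>y \<in> ?X. x < y \<longrightarrow> before \<rho> (?X - {x}) (?X - {y})"
        by (simp add: inversion_graph_def)
      with * asym xy show False by (metis linorder_neqE_nat)
    qed
    with * asym xy show ?thesis by (metis linorder_neqE_nat order_less_asym)
  next
    assume *: "\<forall>x \<in> ?X. \<forall>y \<in> ?X. x < y \<longrightarrow> before \<rho> (?X - {x}) (?X - {y})"
    with e have "e \<in> inversion_graph n \<rho>" by (simp add: inversion_graph_def)
    with * asym xy show ?thesis by (metis linorder_neqE_nat)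
  qed
qed

text \<open>If \<open>y\<close> disagrees with \<open>x\<close> and \<open>z\<close> about adjacency
  to \<open>i\<close>, the packets of \<open>{i, x}\<close>, \<open>{i, y}\<close> and
  \<open>{i, z}\<close> order the complements of the triples \<open>{i, x, y}\<close>,
  \<open>{i, x, z}\<close> and \<open>{i, y, z}\<close> cyclically.\<close>

lemma inversion_graph_segment:
  assumes \<rho>: "\<rho> \<in> admissible_orders n (n - 3)" and n: "n \<ge> 3"
  shows "inversion_graph n \<rho> \<in> segment_graphs n"
proof -
  let ?I = "inversion_graph n \<rho>"
  have dist: "distinct \<rho>"
    using \<rho> by (simp add: admissible_orders_def total_orders_def)
  have "{i, y} \<in> ?I \<longleftrightarrow> {i, z} \<in> ?I"
    if V: "i \<in> {1..n}" "x \<in> {1..n}" "y \<in> {1..n}" "z \<in> {1..n}"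
      and *: "x < y" "y < z" "i \<notin> {x, y, z}" "{i, x} \<in> ?I \<longleftrightarrow> {i, z} \<in> ?I" for i x y z
  proof (rule ccontr)
    assume neg: "\<not> ({i, y} \<in> ?I \<longleftrightarrow> {i, z} \<in> ?I)"
    \<comment> \<open>\<open>K a b\<close> lies in the packets belonging to \<open>{i, a}\<close>
      and to \<open>{i, b}\<close>; this overlap links the three comparisons.\<close>
    define K where "K a b = {1..n} - {i, a, b}" for a b
    have K: "K a b = {1..n} - {i, a} - {b}" "K a b = K b a" for a b
      by (auto simp: K_def)
    have B: "before \<rho> (K a b) (K a c) \<longleftrightarrow> ({i, a} \<in> ?I \<longleftrightarrow> b < c)"
      if "a \<in> {1..n}" "b \<in> {1..n}" "c \<in> {1..n}" "distinct [i, a, b, c]" for a b c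
      unfolding K(1) using inversion_graph_iff[OF \<rho> n, of "{i, a}" b c] that V by auto
    show False
    proof (cases "{i, x} \<in> ?I")
      case True
      then have "before \<rho> (K x y) (K x z)" "before \<rho> (K z x) (K z y)" "before \<rho> (K y z) (K y x)"
        using B[of x y z] B[of z x y] B[of y z x] V * neg by auto
      then show False using dist before_trans before_asym K(2) by metis
    next
      case False
      then have "before \<rho> (K x z) (K x y)" "before \<rho> (K z y) (K z x)" "before \<rho> (K y x) (K y z)"
        using B[of x z y] B[of z y x] B[of y x z] V * neg by auto
      then show False using dist before_trans before_asym K(2) by metis
    qed
  qed
  moreover have "?I \<subseteq> pairs {1..n}" by (auto simp: inversion_graph_def)
  ultimately show ?thesis unfolding segment_graphs_def by blast
qed

text \<open>For \<open>n \<ge> 4\<close> each packet has at least two members, so its lex and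
  antilex orders differ and its orientation is visible.\<close>

lemma pair_of_others:
  assumes "e \<in> pairs {1..n}" "n \<ge> 4"
  obtains x y where "x \<in> {1..n} - e" "y \<in> {1..n} - e" "x < y"
proof -
  have "card ({1..n} - e) \<ge> 2" using assms by (auto simp: pairs_def card_Diff_subset finite_subset)
  then obtain S where "S \<in> pairs ({1..n} - e)"
    by (metis (mono_tags, lifting) CollectI obtain_subset_with_card_n pairs_def)
  then show thesis by (rule pairsE) (rule that)
qed

text \<open>Distinct elements fail to commute exactly when they lie in a common packet, and the
  inversion graph records precisely the order inside packets.\<close>

lemma commutation_equiv_iff:
  assumes \<rho>: "\<rho> \<in> admissible_orders n (n - 3)" and \<sigma>: "\<sigma> \<in> admissible_orders n (n - 3)" and n: "n \<ge> 4"
  shows "(\<rho>, \<sigma>) \<in> commutation_equiv n (n - 3) \<longleftrightarrow> inversion_graph n \<rho> = inversion_graph n \<sigma>"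
proof
  have n3: "n \<ge> 3" using n by simp
  note B = inversion_graph_iff[OF \<rho> n3] inversion_graph_iff[OF \<sigma> n3]
  assume "(\<rho>, \<sigma>) \<in> commutation_equiv n (n - 3)"
  then have moves: "(\<rho>, \<sigma>) \<in> commutation_moves\<^sup>*" by (simp add: commutation_equiv_def)
  have "e \<in> inversion_graph n \<rho> \<longleftrightarrow> e \<in> inversion_graph n \<sigma>" if e: "e \<in> pairs {1..n}" for e
  proof -
    let ?X = "{1..n} - e"
    obtain x y where xy: "x \<in> ?X" "y \<in> ?X" "x < y"
      using pair_of_others[OF e n] .
    \<comment> \<open>Two members of one packet share the set obtained by deleting both
      elements.\<close>
    have nc: "\<not> commute (?X - {a}) (?X - {b})" if "a \<in> ?X" "b \<in> ?X" "a \<noteq> b" for a b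
    proof -
      have "?X - {a} - {b} \<in> packet (?X - {a})" "?X - {b} - {a} \<in> packet (?X - {b})"
        using that by (auto simp: packet_def)
      moreover have "?X - {a} - {b} = ?X - {b} - {a}" by blast
      ultimately show ?thesis unfolding commute_def by (metis IntI empty_iff)
    qed
    show ?thesis
      using before_if_commutation_moves[OF moves, of "?X - {x}" "?X - {y}"]
        before_if_commutation_moves[OF moves, of "?X - {y}" "?X - {x}"]
        nc[of x y] nc[of y x] B[OF e, of x y] B[OF e, of y x] xy
      by auto
  qed
  then show "inversion_graph n \<rho> = inversion_graph n \<sigma>"
    by (auto simp: inversion_graph_def)
next
  have n3: "n \<ge> 3" using n by simp
  assume eq: "inversion_graph n \<rho> = inversion_graph n \<sigma>"
  have tot: "distinct \<rho>" "set \<rho> = ksubsets n (n - 3)" "distinct \<sigma>" "set \<sigma> = ksubsets n (n - 3)"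
    using \<rho> \<sigma> by (auto simp: admissible_orders_def total_orders_def)
  have "(\<rho>, \<sigma>) \<in> commutation_moves\<^sup>*"
  proof (rule commutation_moves_if_before)
    fix K K' assume bef: "before \<sigma> K K'" and nc: "\<not> commute K K'"
    from nc obtain k k' where k: "k \<in> K" "k' \<in> K'" "K - {k} = K' - {k'}"
      by (auto simp: commute_def packet_def)
    have KK: "K \<in> ksubsets n (n - 3)" "K' \<in> ksubsets n (n - 3)" "K \<noteq> K'"
      using before_in_set[OF bef] tot before_asym[OF tot(3) bef] bef by auto
    then have "k \<noteq> k'" using k by (metis insert_Diff)
    then have k': "k' \<notin> K" "k \<notin> K'" using k by blast+
    \<comment> \<open>\<open>X\<close> is the union of \<open>K\<close> and \<open>K'\<close>, which
      differ by one exchange; both lie in its packet.\<close>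
    define X where "X = insert k' K"
    have X: "K = X - {k'}" "K' = X - {k}" "X \<subseteq> {1..n}"
      using k k' \<open>k \<noteq> k'\<close> KK unfolding X_def ksubsets_def by blast+
    define e where "e = {1..n} - X"
    have "finite K" using KK by (auto simp: ksubsets_def intro: finite_subset)
    then have "card X = n - 2"
      using KK k' n by (simp add: X_def ksubsets_def)
    then have e: "e \<in> pairs {1..n}"
      using X n by (auto simp: e_def pairs_def card_Diff_subset finite_subset)
    have Xe: "X = {1..n} - e" using X by (auto simp: e_def)
    have "k' \<in> {1..n} - e" "k \<in> {1..n} - e"
      unfolding Xe[symmetric] using k by (auto simp: X_def)
    then show "before \<rho> K K'"
      using bef inversion_graph_iff[OF \<rho> n3 e, of k' k] inversion_graph_iff[OF \<sigma> n3 e, of k' k]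
        eq \<open>k \<noteq> k'\<close> unfolding X(1,2) Xe by simp
  qed (use tot in auto)
  then show "(\<rho>, \<sigma>) \<in> commutation_equiv n (n - 3)"
    using \<rho> \<sigma> by (simp add: commutation_equiv_def)
qed

section \<open>Realizing segment graphs by ranking triples\<close>

text \<open>
  The rank of a triple \<open>a < b < c\<close> is dominated by \<open>c\<close>, with sign given by whether
  \<open>{a, b}\<close> is an edge. Ties are broken by a rank of the pair \<open>{a, b}\<close> in the link of \<open>c\<close>,
  where the pairs through a fixed vertex \<open>x\<close> must increase in the other vertex if \<open>x \<in> N(c)\<close>
  and decrease otherwise; below, \<open>A\<close> and \<open>B\<close> stand for \<open>a \<in> N(c)\<close> and \<open>b \<in> N(c)\<close>.
  If \<open>N(c)\<close> is initial, the mixed pairs come after the others, if it is final, before them.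
\<close>
definition link_rank :: "nat \<Rightarrow> bool \<Rightarrow> bool \<Rightarrow> nat \<Rightarrow> nat \<Rightarrow> int" where
  "link_rank n A B a b =
    (if A then if B then int a + int b else 4 * int n + int b - int a
     else if B then int a - int b - 4 * int n else - int a - int b)"

definition triple_rank :: "nat \<Rightarrow> nat set set \<Rightarrow> nat set \<Rightarrow> int" where
  "triple_rank n E T = (let a = Min T; b = Min (T - {a}); c = Max T in
     (if {a, b} \<in> E then 1 else - 1) * (20 * int n * int c) + link_rank n ({a, c} \<in> E) ({b, c} \<in> E) a b)"

lemma triple_rank_eq:
  assumes "a < b" "b < c"
  shows "triple_rank n E {a, b, c} =
    (if {a, b} \<in> E then 1 else - 1) * (20 * int n * int c) + link_rank n ({a, c} \<in> E) ({b, c} \<in> E) a b"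
proof -
  have "Min {a, b, c} = a" "Max {a, b, c} = c" "{a, b, c} - {a} = {b, c}" "Min {b, c} = b"
    using assms by auto
  then show ?thesis by (simp add: triple_rank_def)
qed

lemma link_rank_bound:
  assumes "a < b" "b \<le> n"
  shows "\<bar>link_rank n A B a b\<bar> \<le> 5 * int n"
  using assms by (auto simp: link_rank_def)

text \<open>Each of the six pairs in a quadruple must order the two triples containing it. In the
  first three claims the triples have different maxima, and the sign of the term for
  \<open>s\<close> decides. In the last three both maxima are \<open>s\<close>, and signs or link
  ranks decide.\<close>

lemma triple_rank_quadruple:
  assumes E: "E \<in> segment_graphs n" and V: "1 \<le> p" "p < q" "q < r" "r < s" "s \<le> n"
  shows "if {p, q} \<in> E then triple_rank n E {p, q, r} < triple_rank n E {p, q, s} else triple_rank n E {p, q, s} < triple_rank n E {p, q, r}"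
    and "if {p, r} \<in> E then triple_rank n E {p, q, r} < triple_rank n E {p, r, s} else triple_rank n E {p, r, s} < triple_rank n E {p, q, r}"
    and "if {q, r} \<in> E then triple_rank n E {p, q, r} < triple_rank n E {q, r, s} else triple_rank n E {q, r, s} < triple_rank n E {p, q, r}"
    and "if {p, s} \<in> E then triple_rank n E {p, q, s} < triple_rank n E {p, r, s} else triple_rank n E {p, r, s} < triple_rank n E {p, q, s}"
    and "if {q, s} \<in> E then triple_rank n E {p, q, s} < triple_rank n E {q, r, s} else triple_rank n E {q, r, s} < triple_rank n E {p, q, s}"
    and "if {r, s} \<in> E then triple_rank n E {p, r, s} < triple_rank n E {q, r, s} else triple_rank n E {q, r, s} < triple_rank n E {p, r, s}"
proof -
  define R where "R = 20 * int n * int r"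
  define S where "S = 20 * int n * int s"
  have "int n * (int r + 1) \<le> int n * int s" "int n * 1 \<le> int n * int r"
    using V by (intro mult_left_mono; simp)+
  \<comment> \<open>Two link ranks differ by at most \<open>10 * int n\<close>, so these gaps cannot
    be overturned by them.\<close>
  then have RS: "20 * int n \<le> R" "R + 20 * int n \<le> S"
    unfolding R_def S_def by (auto simp: algebra_simps)
  have n: "int n > 0" using V by simp
  define pq pr ps qr qs rs where b: "pq \<longleftrightarrow> {p, q} \<in> E" "pr \<longleftrightarrow> {p, r} \<in> E" "ps \<longleftrightarrow> {p, s} \<in> E"
    "qr \<longleftrightarrow> {q, r} \<in> E" "qs \<longleftrightarrow> {q, s} \<in> E" "rs \<longleftrightarrow> {r, s} \<in> E"
  \<comment> \<open>The segment condition at \<open>p\<close>, \<open>q\<close>, \<open>r\<close>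
    and \<open>s\<close>, each applied to the other three vertices.\<close>
  have seg: "pq = ps \<Longrightarrow> pr = ps" "pq = qs \<Longrightarrow> qr = qs" "pr = rs \<Longrightarrow> qr = rs" "ps = rs \<Longrightarrow> qs = rs"
    using segment_graphsD(2)[OF E, of p q s r] segment_graphsD(2)[OF E, of q p s r]
      segment_graphsD(2)[OF E, of r p s q] segment_graphsD(2)[OF E, of s p r q] V
    by (auto simp: b insert_commute)
  have rank: "triple_rank n E {p, q, r} = (if pq then 1 else - 1) * R + link_rank n pr qr p q"
    "triple_rank n E {p, q, s} = (if pq then 1 else - 1) * S + link_rank n ps qs p q"
    "triple_rank n E {p, r, s} = (if pr then 1 else - 1) * S + link_rank n ps rs p r"
    "triple_rank n E {q, r, s} = (if qr then 1 else - 1) * S + link_rank n qs rs q r"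
    using V by (simp_all add: triple_rank_eq R_def S_def b)
  have bounds: "\<bar>link_rank n A B p q\<bar> \<le> 5 * int n" "\<bar>link_rank n A B p r\<bar> \<le> 5 * int n"
    "\<bar>link_rank n A B q r\<bar> \<le> 5 * int n" for A B
    using V by (simp_all add: link_rank_bound)
  note bnds = bounds(1)[of pr qr] bounds(1)[of ps qs] bounds(2)[of ps rs] bounds(3)[of qs rs]
  show "if {p, q} \<in> E then triple_rank n E {p, q, r} < triple_rank n E {p, q, s} else triple_rank n E {p, q, s} < triple_rank n E {p, q, r}"
    unfolding rank b(1)[symmetric] using RS bnds n by (cases pq) auto
  show "if {p, r} \<in> E then triple_rank n E {p, q, r} < triple_rank n E {p, r, s} else triple_rank n E {p, r, s} < triple_rank n E {p, q, r}"
    unfolding rank b(2)[symmetric] using RS bnds n by (cases pq; cases pr) auto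
  show "if {q, r} \<in> E then triple_rank n E {p, q, r} < triple_rank n E {q, r, s} else triple_rank n E {q, r, s} < triple_rank n E {p, q, r}"
    unfolding rank b(4)[symmetric] using RS bnds n by (cases pq; cases qr) auto
  \<comment> \<open>With equal signs the link ranks decide, and \<open>seg(4)\<close> excludes
    patterns at \<open>s\<close> that are not segments. With different signs, \<open>seg(1)\<close>
    forces \<open>pr = ps\<close>, so the signs point the right way. The next two claims are
    analogous.\<close>
  show "if {p, s} \<in> E then triple_rank n E {p, q, s} < triple_rank n E {p, r, s} else triple_rank n E {p, r, s} < triple_rank n E {p, q, s}"
  proof (cases "pq = pr")
    case True
    then show ?thesis
      unfolding rank b(3)[symmetric] link_rank_def using seg(4) V by (cases ps; cases qs; cases rs) auto
  next
    case False
    then show ?thesis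
      unfolding rank b(3)[symmetric] using seg(1) RS bnds n by (cases pq; cases ps) auto
  qed
  show "if {q, s} \<in> E then triple_rank n E {p, q, s} < triple_rank n E {q, r, s} else triple_rank n E {q, r, s} < triple_rank n E {p, q, s}"
  proof (cases "pq = qr")
    case True
    then show ?thesis
      unfolding rank b(5)[symmetric] link_rank_def using seg(4) V by (cases ps; cases qs; cases rs) auto
  next
    case False
    then show ?thesis
      unfolding rank b(5)[symmetric] using seg(2) RS bnds n by (cases pq; cases qs) auto
  qed
  show "if {r, s} \<in> E then triple_rank n E {p, r, s} < triple_rank n E {q, r, s} else triple_rank n E {q, r, s} < triple_rank n E {p, r, s}"
  proof (cases "pr = qr")
    case True
    then show ?thesis
      unfolding rank b(6)[symmetric] link_rank_def using seg(4) V by (cases ps; cases qs; cases rs) auto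
  next
    case False
    then show ?thesis
      unfolding rank b(6)[symmetric] using seg(3) RS bnds n by (cases pr; cases rs) auto
  qed
qed

text \<open>The six interleavings of \<open>x < y\<close> with the two ends of \<open>e\<close>
  match the six claims of \<open>triple_rank_quadruple\<close>.\<close>

lemma triple_rank_mono:
  assumes E: "E \<in> segment_graphs n" and e: "e \<in> pairs {1..n}"
    and xy: "x \<in> {1..n} - e" "y \<in> {1..n} - e" "x < y"
  shows "if e \<in> E then triple_rank n E (insert x e) < triple_rank n E (insert y e)
    else triple_rank n E (insert y e) < triple_rank n E (insert x e)"
proof -
  obtain a b where ab: "e = {a, b}" "a \<in> {1..n}" "b \<in> {1..n}" "a < b"
    using e by (rule pairsE)
  note Q = triple_rank_quadruple[OF E]
  consider "y < a" | "x < a" "a < y" "y < b" | "x < a" "b < y" | "a < x" "y < b"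
    | "a < x" "x < b" "b < y" | "b < x"
    using xy ab by fastforce
  then show ?thesis
  proof cases
    case 1
    then show ?thesis using Q(6)[of x y a b] xy ab by (cases "{a, b} \<in> E") (simp_all add: insert_commute)
  next
    case 2
    then show ?thesis using Q(5)[of x a y b] xy ab by (cases "{a, b} \<in> E") (simp_all add: insert_commute)
  next
    case 3
    then show ?thesis using Q(3)[of x a b y] xy ab by (cases "{a, b} \<in> E") (simp_all add: insert_commute)
  next
    case 4
    then show ?thesis using Q(4)[of a x y b] xy ab by (cases "{a, b} \<in> E") (simp_all add: insert_commute)
  next
    case 5
    then show ?thesis using Q(2)[of a x b y] xy ab by (cases "{a, b} \<in> E") (simp_all add: insert_commute)
  next
    case 6
    then show ?thesis using Q(1)[of a b x y] xy ab by (cases "{a, b} \<in> E") (simp_all add: insert_commute)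
  qed
qed


lemma sort_key_before:
  assumes "x \<in> set xs" "y \<in> set xs" "f x < f y"
  shows "before (sort_key f xs) x y"
proof -
  have "sorted_wrt (\<lambda>x y. f x \<le> f y) (sort_key f xs)"
    using sorted_sort_key[of f xs] by (simp add: sorted_map)
  then have "\<not> before (sort_key f xs) y x"
    using assms(3) unfolding sorted_wrt_iff_before by fastforce
  moreover have "x \<noteq> y" using assms(3) by auto
  ultimately show ?thesis
    using before_total[of x "sort_key f xs" y] assms by simp
qed

text \<open>Sort all elements by the rank of their complementary triple. Equal ranks may be resolved
  arbitrarily, because inside a packet \<open>triple_rank_mono\<close> gives strict
  inequalities.\<close>

lemma segment_graph_realizable:
  assumes E: "E \<in> segment_graphs n" and n: "n \<ge> 4"
  obtains \<rho> where "\<rho> \<in> admissible_orders n (n - 3)" "inversion_graph n \<rho> = E"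
proof -
  have "finite (ksubsets n (n - 3))"
    by (rule finite_subset[of _ "Pow {1..n}"]) (auto simp: ksubsets_def)
  then obtain xs where xs: "set xs = ksubsets n (n - 3)" "distinct xs"
    using finite_distinct_list by blast
  define rank where "rank K = triple_rank n E ({1..n} - K)" for K
  define \<rho> where "\<rho> = sort_key rank xs"
  have tot: "\<rho> \<in> total_orders (ksubsets n (n - 3))"
    using xs by (simp add: total_orders_def \<rho>_def)
  have bef: "if e \<in> E then before \<rho> ({1..n} - e - {x}) ({1..n} - e - {y})
      else before \<rho> ({1..n} - e - {y}) ({1..n} - e - {x})"
    if e: "e \<in> pairs {1..n}" and xy: "x \<in> {1..n} - e" "y \<in> {1..n} - e" "x < y" for e x y
  proof -
    have sub: "e \<subseteq> {1..n}" "finite e" using e by (auto simp: pairs_def intro: finite_subset)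
    have compl: "{1..n} - ({1..n} - e - {z}) = insert z e" if "z \<in> {1..n} - e" for z
      using that sub by blast
    have mem: "{1..n} - e - {z} \<in> set xs" if "z \<in> {1..n} - e" for z
      using that sub e n unfolding xs by (auto simp: pairs_def ksubsets_def card_Diff_subset)
    have "rank ({1..n} - e - {z}) = triple_rank n E (insert z e)" if "z \<in> {1..n} - e" for z
      by (simp only: rank_def compl[OF that])
    then show ?thesis
      using triple_rank_mono[OF E e xy] mem xy
        sort_key_before[of "{1..n} - e - {x}" xs "{1..n} - e - {y}" rank]
        sort_key_before[of "{1..n} - e - {y}" xs "{1..n} - e - {x}" rank]
      unfolding \<rho>_def by (cases "e \<in> E") simp_all
  qed
  have adm: "\<rho> \<in> admissible_orders n (n - 3)"
    unfolding admissible_orders_iff[OF tot]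
  proof
    fix X assume X: "X \<in> ksubsets n (n - 3 + 1)"
    define e where "e = {1..n} - X"
    have X': "X \<subseteq> {1..n}" "card X = n - 2" using X n by (simp_all add: ksubsets_def)
    then have "finite X" by (auto intro: finite_subset)
    then have "card e = 2"
      using X' n by (simp add: e_def card_Diff_subset)
    then have e: "e \<in> pairs {1..n}" by (simp add: pairs_def e_def)
    have "{1..n} - e = X" using X' by (auto simp: e_def)
    note bef = bef[OF e, unfolded this]
    show "(\<forall>x \<in> X. \<forall>y \<in> X. x < y \<longrightarrow> before \<rho> (X - {y}) (X - {x})) \<or>
        (\<forall>x \<in> X. \<forall>y \<in> X. x < y \<longrightarrow> before \<rho> (X - {x}) (X - {y}))"
    proof (cases "e \<in> E")
      case True
      with bef show ?thesis by (simp only: if_True) blast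
    next
      case False
      with bef show ?thesis by (simp only: if_False) blast
    qed
  qed
  have "e \<in> inversion_graph n \<rho> \<longleftrightarrow> e \<in> E" if e: "e \<in> pairs {1..n}" for e
  proof
    obtain x y where xy: "x \<in> {1..n} - e" "y \<in> {1..n} - e" "x < y"
      using pair_of_others[OF e n] .
    then show "e \<in> inversion_graph n \<rho> \<Longrightarrow> e \<in> E"
      using bef[OF e xy] inversion_graph_iff[OF adm _ e, of y x] n by (auto split: if_splits)
  next
    assume "e \<in> E"
    with bef[OF e] e show "e \<in> inversion_graph n \<rho>"
      unfolding inversion_graph_def by simp
  qed
  then have "inversion_graph n \<rho> = E"
    using segment_graphsD(1)[OF E] by (auto simp: inversion_graph_def)
  with adm show thesis by (rule that)
qed

section \<open>Counting the classes\<close>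

text \<open>The classes are the nonempty fibres of \<open>f\<close> on \<open>A\<close>, hence
  indexed by its values.\<close>

lemma card_quotient_kernel:
  assumes "R \<subseteq> A \<times> A" "\<And>x y. x \<in> A \<Longrightarrow> y \<in> A \<Longrightarrow> (x, y) \<in> R \<longleftrightarrow> f x = f y"
  shows "card (A // R) = card (f ` A)"
proof -
  let ?g = "\<lambda>v. {y \<in> A. v = f y}"
  have "R `` {x} = ?g (f x)" if "x \<in> A" for x
    using that assms by blast
  then have "A // R = ?g ` f ` A"
    unfolding quotient_def by auto
  moreover have "inj_on ?g (f ` A)"
    by (rule inj_onI) blast
  ultimately show ?thesis by (simp add: card_image)
qed

theorem theorem50:
  fixes n :: nat
  assumes "n \<ge> 4"
  shows "int (card (higher_bruhat n (n - 3))) = 2 ^ n + int n * 2 ^ (n - 2) - 2 * int n"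
proof -
  have "card (higher_bruhat n (n - 3)) = card (inversion_graph n ` admissible_orders n (n - 3))"
    unfolding higher_bruhat_def
    by (rule card_quotient_kernel)
      (use commutation_equiv_iff[OF _ _ assms] in \<open>auto simp: commutation_equiv_def\<close>)
  also have "inversion_graph n ` admissible_orders n (n - 3) = segment_graphs n"
  proof (intro equalityI subsetI)
    fix E assume "E \<in> segment_graphs n"
    then show "E \<in> inversion_graph n ` admissible_orders n (n - 3)"
      using segment_graph_realizable[OF _ assms] by blast
  qed (use inversion_graph_segment[of _ n] assms in auto)
  finally show ?thesis
    using card_segment_graphs[OF assms] by simp
qed

end
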